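(* Let $\mu$ be a probability measure on $\mathbb{R}^n$ with density $e^{-V}$, where $V:\mathbb{R}^n\to\mathbb{R}$ is a $\mathcal C^2$ function satisfying $\mathrm{Hess}(V)>0$. Then for any $\mathcal C^1$ and compactly supported function $f$ on $\mathbb{R}^n$ such that $\int f\,d\mu=0$, $$\mathrm{Var}_\mu(f)\le\int\nabla f\cdot\mathrm{Hess}(V)^{-1}\nabla f\,d\mu-\int\frac{\big(f-\nabla f\cdot\mathrm{Hess}(V)^{-1}\nabla V\big)^2}{n+\nabla V\cdot\mathrm{Hess}(V)^{-1}\nabla V}\,d\mu.$$
   Context: Densities are with respect to Lebesgue measure. $\mathrm{Hess}(V)>0$ means that the Hessian matrix is positive definite at every point. $\mathrm{Var}_\mu(f)=\int f^2d\mu-\big(\int f\,d\mu\big)^2$. *)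

theory Defs
  imports "HOL-Probability.Probability"
begin

definition grad :: "(real^'n \<Rightarrow> real) \<Rightarrow> real^'n \<Rightarrow> real^'n" where
  "grad f x = (\<chi> i. frechet_derivative f (at x) (axis i 1))"

definition hess :: "(real^'n \<Rightarrow> real) \<Rightarrow> real^'n \<Rightarrow> real^'n^'n" where
  "hess f x = jacobian (grad f) (at x)"

definition C1 :: "(real^'n \<Rightarrow> real) \<Rightarrow> bool" where
  "C1 f \<longleftrightarrow> (\<forall>x. f differentiable (at x)) \<and> continuous_on UNIV (grad f)"

definition C2 :: "(real^'n \<Rightarrow> real) \<Rightarrow> bool" where
  "C2 f \<longleftrightarrow> C1 f \<and> (\<forall>x. grad f differentiable (at x)) \<and> continuous_on UNIV (hess f)"

definition compactly_supported :: "(real^'n \<Rightarrow> real) \<Rightarrow> bool" where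
  "compactly_supported f \<longleftrightarrow> compact (closure {x. f x \<noteq> 0})"

text \<open>Symmetry is not part of this definition; the Hessian of a \<open>C2\<close> function,
  to which it is applied, is automatically symmetric.\<close>

definition pos_def :: "real^'n^'n \<Rightarrow> bool" where
  "pos_def A \<longleftrightarrow> (\<forall>v. v \<noteq> 0 \<longrightarrow> v \<bullet> (A *v v) > 0)"

definition Var :: "'a measure \<Rightarrow> ('a \<Rightarrow> real) \<Rightarrow> real" where
  "Var M f = (\<integral>x. (f x)\<^sup>2 \<partial>M) - (\<integral>x. f x \<partial>M)\<^sup>2"

end

theory Submission
  imports Defs
begin

text \<open>The inequality is the second-order expansion, as \<open>s \<rightarrow> 0\<close>, of the Borell--Brascamp--Lieb inequality
with exponent \<open>-1/n\<close>. That inequality says: if three nonnegative functions satisfy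
\<open>H ((x + y) / 2) \<ge> ((F x powr (-1/n) + G y powr (-1/n)) / 2) powr (-n)\<close> for all \<open>x\<close> and \<open>y\<close>,
then \<open>\<integral> H \<ge> min (\<integral> F) (\<integral> G)\<close>. It is applied to
\<open>F = exp (-(V - s f))\<close>, \<open>G = exp (-(V + s f))\<close> and \<open>H = exp (-(V - s\<^sup>2 k / 2))\<close>. As \<open>\<integral> f d\<mu> = 0\<close>, both
\<open>\<integral> F\<close> and \<open>\<integral> G\<close> are \<open>1 + s\<^sup>2/2 \<integral> f\<^sup>2 d\<mu> + O(s\<^sup>3)\<close>, while
\<open>\<integral> H = 1 + s\<^sup>2/2 \<integral> k d\<mu> + O(s\<^sup>4)\<close>; comparison of the terms of order \<open>s\<^sup>2\<close> gives
\<open>\<integral> f\<^sup>2 d\<mu> \<le> \<integral> k d\<mu>\<close>.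

It remains to see how small \<open>k\<close> may be. With \<open>z = (x + y) / 2\<close> and \<open>y - x = 2 h\<close>, the hypothesis of
Borell--Brascamp--Lieb expands to nonnegativity, up to \<open>o(|h|\<^sup>2 + s\<^sup>2)\<close>, of the quadratic form in \<open>(h, s)\<close>
\<open>Hess V h \<bullet> h + 2 s \<nabla>f \<bullet> h + (\<nabla>V \<bullet> h + s f)\<^sup>2 / n + s\<^sup>2 k(z)\<close>.
Minimising over \<open>h\<close>, this holds exactly when
\<open>k \<ge> \<nabla>f \<bullet> Hess(V)\<inverse> \<nabla>f - (f - \<nabla>f \<bullet> Hess(V)\<inverse> \<nabla>V)\<^sup>2 / (n + \<nabla>V \<bullet> Hess(V)\<inverse> \<nabla>V)\<close>,
whose right-hand side is the integrand to be reached (\<open>bl_density_quadratic_nonneg\<close>). Adding \<open>\<epsilon>\<close> to it on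
a ball around the support of \<open>f\<close> makes the form positive definite, uniformly on that ball, and this
absorbs the remainder for small \<open>h\<close> (\<open>local_comparison\<close>). For large \<open>h\<close> the strict convexity of \<open>V\<close>
leaves a fixed amount of room, whereas the perturbations by \<open>s f\<close> and \<open>s\<^sup>2 k\<close> are small
(\<open>global_comparison\<close>). Finally \<open>\<epsilon> \<rightarrow> 0\<close>.

The Borell--Brascamp--Lieb inequality itself is proved by induction on the dimension: integrating out
one real variable turns the exponent \<open>-1/(k+1)\<close> into \<open>-1/k\<close>
(\<open>borell_brascamp_lieb_line\<close>), which follows from the Brunn--Minkowski inequality on the line applied to
superlevel sets.\<close>

section \<open>The Borell--Brascamp--Lieb inequality on the line\<close>

text \<open>Cut \<open>A\<close> just below its supremum at \<open>a \<in> A\<close> and \<open>B\<close> just above its infimum at \<open>b \<in> B\<close>, losing measure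
at most \<open>e\<close> in total. The averages of the lower part of \<open>A\<close> with \<open>b\<close> lie to the left of
\<open>(a + b) / 2\<close>, the averages of \<open>a\<close> with the upper part of \<open>B\<close> to its right, so the two half-size copies
occupy disjoint portions of \<open>C\<close>.\<close>

lemma brunn_minkowski_line:
  fixes A B C :: "real set"
  assumes [measurable]: "A \<in> sets borel" "B \<in> sets borel" "C \<in> sets borel"
    and "bounded A" "bounded B" "A \<noteq> {}" "B \<noteq> {}"
    and mid: "\<And>x y. x \<in> A \<Longrightarrow> y \<in> B \<Longrightarrow> (x + y) / 2 \<in> C"
  shows "emeasure lborel A + emeasure lborel B \<le> 2 * emeasure lborel C"
proof (rule ennreal_le_epsilon)
  fix e :: real assume "0 < e"
  have bA: "bdd_above A" and bB: "bdd_below B"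
    using assms bounded_imp_bdd_above bounded_imp_bdd_below by auto
  obtain a where a: "a \<in> A" "Sup A - e / 2 < a"
    using less_cSup_iff[OF \<open>A \<noteq> {}\<close> bA, of "Sup A - e / 2"] \<open>0 < e\<close> by auto
  obtain b where b: "b \<in> B" "b < Inf B + e / 2"
    using cInf_less_iff[OF \<open>B \<noteq> {}\<close> bB, of "Inf B + e / 2"] \<open>0 < e\<close> by auto
  define m where "m = (a + b) / 2"
  have leA: "emeasure lborel A \<le> emeasure lborel (A \<inter> {..<a}) + ennreal (e / 2)"
  proof -
    have "A \<subseteq> (A \<inter> {..<a}) \<union> {a..Sup A}"
      using bA by (auto intro: cSup_upper)
    hence "emeasure lborel A \<le> emeasure lborel ((A \<inter> {..<a}) \<union> {a..Sup A})"
      by (intro emeasure_mono) auto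
    also have "\<dots> \<le> emeasure lborel (A \<inter> {..<a}) + emeasure lborel {a..Sup A}"
      by (intro emeasure_subadditive) auto
    also have "\<dots> \<le> emeasure lborel (A \<inter> {..<a}) + ennreal (e / 2)"
      using a by (intro add_left_mono) (auto simp: emeasure_lborel_Icc_eq intro!: ennreal_leI)
    finally show ?thesis .
  qed
  have leB: "emeasure lborel B \<le> emeasure lborel (B \<inter> {b..}) + ennreal (e / 2)"
  proof -
    have "B \<subseteq> (B \<inter> {b..}) \<union> {Inf B..b}"
      using bB by (auto intro: cInf_lower)
    hence "emeasure lborel B \<le> emeasure lborel ((B \<inter> {b..}) \<union> {Inf B..b})"
      by (intro emeasure_mono) auto
    also have "\<dots> \<le> emeasure lborel (B \<inter> {b..}) + emeasure lborel {Inf B..b}"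
      by (intro emeasure_subadditive) auto
    also have "\<dots> \<le> emeasure lborel (B \<inter> {b..}) + ennreal (e / 2)"
      using b by (intro add_left_mono) (auto simp: emeasure_lborel_Icc_eq intro!: ennreal_leI)
    finally show ?thesis .
  qed
  have half: "emeasure lborel D \<le> 2 * emeasure lborel E"
    if [measurable]: "D \<in> sets borel" "E \<in> sets borel"
      and sub: "\<And>x. x \<in> D \<Longrightarrow> c / 2 + (1 / 2) * x \<in> E" for D E :: "real set" and c
  proof -
    have "2 * emeasure lborel E = 2 * (\<integral>\<^sup>+x. indicator E x \<partial>lborel)" by simp
    also have "\<dots> = 2 * (ennreal (1 / 2) * (\<integral>\<^sup>+x. indicator E (c / 2 + (1 / 2) * x) \<partial>lborel))"
      by (subst nn_integral_real_affine[where c="1/2" and t="c/2"]) auto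
    also have "\<dots> = ennreal (2 * (1/2)) * (\<integral>\<^sup>+x. indicator E (c / 2 + (1 / 2) * x) \<partial>lborel)"
      by (subst ennreal_mult) (auto simp: mult.assoc)
    also have "\<dots> = (\<integral>\<^sup>+x. indicator E (c / 2 + (1 / 2) * x) \<partial>lborel)" by simp
    also have "\<dots> \<ge> (\<integral>\<^sup>+x. indicator D x \<partial>lborel)"
      using sub by (intro nn_integral_mono) (auto split: split_indicator)
    finally show ?thesis by simp
  qed
  have "emeasure lborel (A \<inter> {..<a}) \<le> 2 * emeasure lborel (C \<inter> {..<m})"
    using mid[OF _ b(1)] by (intro half[where c=b]) (auto simp: m_def field_simps)
  moreover have "emeasure lborel (B \<inter> {b..}) \<le> 2 * emeasure lborel (C \<inter> {m..})"
    using mid[OF a(1)] by (intro half[where c=a]) (auto simp: m_def field_simps)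
  moreover have "emeasure lborel C = emeasure lborel (C \<inter> {..<m}) + emeasure lborel (C \<inter> {m..})"
    by (subst plus_emeasure) (auto intro!: arg_cong[where f="emeasure lborel"])
  ultimately have *: "emeasure lborel (A \<inter> {..<a}) + emeasure lborel (B \<inter> {b..}) \<le> 2 * emeasure lborel C"
    by (simp add: add_mono distrib_left)
  have "emeasure lborel A + emeasure lborel B
      \<le> (emeasure lborel (A \<inter> {..<a}) + ennreal (e / 2)) + (emeasure lborel (B \<inter> {b..}) + ennreal (e / 2))"
    by (intro add_mono leA leB)
  also have "\<dots> = (emeasure lborel (A \<inter> {..<a}) + emeasure lborel (B \<inter> {b..})) + (ennreal (e / 2) + ennreal (e / 2))"
    by (simp add: ac_simps)
  also have "\<dots> \<le> 2 * emeasure lborel C + ennreal e"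
    using * \<open>0 < e\<close> by (simp add: ennreal_plus[symmetric] add_right_mono del: ennreal_plus)
  finally show "emeasure lborel A + emeasure lborel B \<le> 2 * emeasure lborel C + ennreal e" .
qed

text \<open>The layer-cake formula, with levels rescaled to \<open>(0, 1)\<close> so that functions with different suprema
can be compared at the same proportion of their maximum.\<close>

lemma nn_integral_layers:
  fixes F :: "real \<Rightarrow> ennreal"
  assumes [measurable]: "F \<in> borel_measurable borel" and "0 < a"
  shows "(\<integral>\<^sup>+x. min (F x) (ennreal a) \<partial>lborel)
       = ennreal a * (\<integral>\<^sup>+t. emeasure lborel {x. ennreal (t * a) \<le> F x} * indicator {0<..<1} t \<partial>lborel)"
proof -
  have layer: "min (F x) (ennreal a)
      = (\<integral>\<^sup>+t. ennreal a * (indicator {x. ennreal (t * a) \<le> F x} x * indicator {0<..<1} t) \<partial>lborel)" for x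
  proof -
    obtain r where r: "min (F x) (ennreal a) = ennreal r" "0 \<le> r" "r \<le> a"
    proof (cases "min (F x) (ennreal a)")
      case (real r)
      thus ?thesis using that[of r] \<open>0 < a\<close>
        by (metis ennreal_le_iff less_imp_le min.cobounded2)
    next
      case top
      thus ?thesis by (metis ennreal_neq_top min.cobounded2 top.extremum_unique)
    qed
    have eq: "ennreal (t * a) \<le> F x \<longleftrightarrow> t \<le> r / a" if "0 < t" "t < 1" for t
    proof -
      have "ennreal (t * a) \<le> F x \<longleftrightarrow> ennreal (t * a) \<le> min (F x) (ennreal a)"
        using that \<open>0 < a\<close> by (auto intro!: ennreal_leI)
      thus ?thesis using r that \<open>0 < a\<close> by (simp add: field_simps)
    qed
    have "AE t in lborel. t \<noteq> (1::real)" by (rule AE_lborel_singleton)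
    hence "(\<integral>\<^sup>+t. ennreal a * (indicator {x. ennreal (t * a) \<le> F x} x * indicator {0<..<1} t) \<partial>lborel)
        = (\<integral>\<^sup>+t. ennreal a * indicator {0<..r / a} t \<partial>lborel)"
    proof (intro nn_integral_cong_AE, eventually_elim)
      fix t :: real assume "t \<noteq> 1"
      have "t \<le> r / a \<Longrightarrow> t \<le> 1"
        using r \<open>0 < a\<close> by (meson divide_le_eq_1_pos order_trans)
      thus "ennreal a * (indicator {x. ennreal (t * a) \<le> F x} x * indicator {0<..<1} t)
          = ennreal a * indicator {0<..r / a} t"
        using eq[of t] \<open>t \<noteq> 1\<close> by (auto split: split_indicator)
    qed
    also have "\<dots> = ennreal a * ennreal (r / a)"
      using r \<open>0 < a\<close> by (subst nn_integral_cmult_indicator) auto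
    also have "\<dots> = ennreal r"
      using r \<open>0 < a\<close> by (subst ennreal_mult[symmetric]) auto
    finally show ?thesis using r by simp
  qed
  have "(\<integral>\<^sup>+x. min (F x) (ennreal a) \<partial>lborel)
      = (\<integral>\<^sup>+x. \<integral>\<^sup>+t. ennreal a * (indicator {x. ennreal (t * a) \<le> F x} x * indicator {0<..<1} t) \<partial>lborel \<partial>lborel)"
    using layer by simp
  also have "\<dots> = (\<integral>\<^sup>+t. \<integral>\<^sup>+x. ennreal a * (indicator {x. ennreal (t * a) \<le> F x} x * indicator {0<..<1} t) \<partial>lborel \<partial>lborel)"
    by (rule lborel_pair.Fubini') measurable
  also have "\<dots> = (\<integral>\<^sup>+t. ennreal a * (emeasure lborel {x. ennreal (t * a) \<le> F x} * indicator {0<..<1} t) \<partial>lborel)"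
  proof (rule nn_integral_cong)
    fix t :: real
    have [measurable]: "{x. ennreal (t * a) \<le> F x} \<in> sets borel" by measurable
    show "(\<integral>\<^sup>+x. ennreal a * (indicator {x. ennreal (t * a) \<le> F x} x * indicator {0<..<1} t) \<partial>lborel)
       = ennreal a * (emeasure lborel {x. ennreal (t * a) \<le> F x} * indicator {0<..<1} t)"
      by (simp add: nn_integral_cmult nn_integral_multc)
  qed
  also have "\<dots> = ennreal a * (\<integral>\<^sup>+t. emeasure lborel {x. ennreal (t * a) \<le> F x} * indicator {0<..<1} t \<partial>lborel)"
    by (intro nn_integral_cmult) measurable
  finally show ?thesis .
qed

text \<open>For finite positive \<open>u\<close> and \<open>v\<close> this says that \<open>w\<close> is at least the power mean of \<open>u\<close> and \<open>v\<close> with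
exponent \<open>-1/k\<close>: \<open>\<alpha>\<close> and \<open>\<beta>\<close> range over the upper bounds of \<open>u powr (-1/k)\<close> and \<open>v powr (-1/k)\<close>. The
formulation through thresholds covers the values \<open>0\<close> and \<open>\<infinity>\<close> without conventions for negative powers,
and it also makes sense for \<open>k = 0\<close>, where it reads
\<open>1 \<le> u \<and> 1 \<le> v \<longrightarrow> 1 \<le> w\<close>: the normalised form of \<open>min u v \<le> w\<close>, which is the limit exponent \<open>-\<infinity>\<close>.\<close>

definition power_mean_le :: "nat \<Rightarrow> ennreal \<Rightarrow> ennreal \<Rightarrow> ennreal \<Rightarrow> bool" where
  "power_mean_le k u v w \<longleftrightarrow> (\<forall>\<alpha>>0. \<forall>\<beta>>0.
     ennreal (1 / \<alpha> ^ k) \<le> u \<longrightarrow> ennreal (1 / \<beta> ^ k) \<le> v \<longrightarrow> ennreal (1 / ((\<alpha> + \<beta>) / 2) ^ k) \<le> w)"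

text \<open>Joint convexity of \<open>p ^ (k+1) / \<alpha> ^ k\<close>, the perspective of a power: apply Jensen's inequality for
\<open>x ^ (k+1)\<close> at \<open>p / \<alpha>\<close> and \<open>q / \<beta>\<close> with weights proportional to \<open>\<alpha>\<close> and \<open>\<beta>\<close>.\<close>

lemma perspective_power_convex:
  fixes \<alpha> \<beta> p q :: real
  assumes "0 < \<alpha>" "0 < \<beta>" "0 < p" "0 < q"
  shows "1 / ((\<alpha> + \<beta>) / 2) ^ k
    \<le> 1 / ((p + q) / 2) ^ Suc k * ((p ^ Suc k / \<alpha> ^ k + q ^ Suc k / \<beta> ^ k) / 2)"
proof -
  have cvx: "convex_on {0..} (\<lambda>x::real. x ^ Suc k)"
    by (metis convex_on_subset convex_power_even convex_power_odd convex_real_interval(1) subset_UNIV)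
  have "((\<alpha> / (\<alpha> + \<beta>)) *\<^sub>R (p / \<alpha>) + (\<beta> / (\<alpha> + \<beta>)) *\<^sub>R (q / \<beta>)) ^ Suc k
      \<le> (\<alpha> / (\<alpha> + \<beta>)) * (p / \<alpha>) ^ Suc k + (\<beta> / (\<alpha> + \<beta>)) * (q / \<beta>) ^ Suc k"
    using assms cvx[unfolded convex_on_def, THEN conjunct2, rule_format,
        of "p / \<alpha>" "q / \<beta>" "\<alpha> / (\<alpha> + \<beta>)" "\<beta> / (\<alpha> + \<beta>)"]
    by (simp add: add_divide_distrib[symmetric] mult.commute del: power_Suc)
  hence "((p + q) / (\<alpha> + \<beta>)) ^ Suc k \<le> (p ^ Suc k / \<alpha> ^ k + q ^ Suc k / \<beta> ^ k) / (\<alpha> + \<beta>)"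
    using assms by (simp add: power_divide add_divide_distrib mult.commute)
  from mult_right_mono[OF this, of "\<alpha> + \<beta>"]
  have "(p + q) ^ Suc k / (\<alpha> + \<beta>) ^ k \<le> (p ^ Suc k / \<alpha> ^ k + q ^ Suc k / \<beta> ^ k)"
    using assms by (simp add: power_divide)
  hence "((p + q) / 2) ^ Suc k / ((\<alpha> + \<beta>) / 2) ^ k \<le> (p ^ Suc k / \<alpha> ^ k + q ^ Suc k / \<beta> ^ k) / 2"
    by (simp add: power_divide)
  moreover have "0 < ((p + q) / 2) ^ Suc k" using assms by simp
  ultimately show ?thesis
    by (simp add: pos_le_divide_eq pos_divide_le_eq mult.commute del: power_Suc)
qed

text \<open>Write \<open>sup F = 1 / p ^ (k+1)\<close> and \<open>sup G = 1 / q ^ (k+1)\<close>. The hypothesis is homogeneous, so the level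
sets of \<open>F\<close> and \<open>G\<close> at the proportion \<open>t\<close> of their suprema average into the level set of \<open>H\<close> at the
proportion \<open>t\<close> of \<open>1 / ((p + q) / 2) ^ (k+1)\<close>. Brunn--Minkowski and integration over \<open>t\<close> bound \<open>\<integral> H\<close>
by the arithmetic mean of the normalised integrals of \<open>F\<close> and \<open>G\<close>, and
\<open>perspective_power_convex\<close> eliminates \<open>p\<close> and \<open>q\<close>. Boundedness and bounded supports keep the suprema
finite and, in the induction on the dimension, are inherited by partial integrals.\<close>

lemma borell_brascamp_lieb_line:
  fixes F G H :: "real \<Rightarrow> ennreal"
  assumes [measurable]: "F \<in> borel_measurable borel" "G \<in> borel_measurable borel" "H \<in> borel_measurable borel"
    and mean: "\<And>x y. power_mean_le (Suc k) (F x) (G y) (H ((x + y) / 2))"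
    and bF: "\<And>x. F x \<le> ennreal c * indicator {-R..R} x"
    and bG: "\<And>x. G x \<le> ennreal c * indicator {-R..R} x"
  shows "power_mean_le k (\<integral>\<^sup>+x. F x \<partial>lborel) (\<integral>\<^sup>+x. G x \<partial>lborel) (\<integral>\<^sup>+x. H x \<partial>lborel)"
  unfolding power_mean_le_def
proof (intro allI impI)
  fix \<alpha> \<beta> :: real assume pos: "0 < \<alpha>" "0 < \<beta>"
    and iF: "ennreal (1 / \<alpha> ^ k) \<le> (\<integral>\<^sup>+x. F x \<partial>lborel)"
    and iG: "ennreal (1 / \<beta> ^ k) \<le> (\<integral>\<^sup>+x. G x \<partial>lborel)"
  have sup: "\<exists>p>0. (SUP x. F x) = ennreal (1 / p ^ Suc k)"
    if bF: "\<And>x. F x \<le> ennreal c * indicator {-R..R} x" and "0 < \<alpha>"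
      and iF: "ennreal (1 / \<alpha> ^ k) \<le> (\<integral>\<^sup>+x. F x \<partial>lborel)" for F :: "real \<Rightarrow> ennreal" and \<alpha> :: real
  proof -
    have "F x \<le> ennreal c" for x
      using bF[of x] by (rule order_trans) (auto split: split_indicator)
    hence "(SUP x. F x) \<le> ennreal c" by (rule SUP_least)
    moreover have "(SUP x. F x) \<noteq> 0"
    proof
      assume "(SUP x. F x) = 0"
      hence "F x = 0" for x by (metis UNIV_I SUP_upper le_zero_eq)
      hence "(\<integral>\<^sup>+x. F x \<partial>lborel) = 0" by simp
      hence "1 / \<alpha> ^ k \<le> 0" using iF by (simp add: ennreal_eq_0_iff)
      moreover have "0 < 1 / \<alpha> ^ k" using \<open>0 < \<alpha>\<close> by simp
      ultimately show False by linarith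
    qed
    ultimately obtain a where a: "0 < a" "(SUP x. F x) = ennreal a"
    proof (cases "SUP x. F x")
      case (real r)
      with \<open>(SUP x. F x) \<noteq> 0\<close> have "0 < r" by (cases "r = 0") auto
      with real that show ?thesis by blast
    qed (simp add: top_unique)
    have "1 / (1 / root (Suc k) a) ^ Suc k = a"
      using a by (simp add: power_divide real_root_pow_pos del: power_Suc)
    thus ?thesis using a by (metis real_root_gt_0_iff zero_less_Suc zero_less_divide_1_iff)
  qed
  obtain p where p: "0 < p" "(SUP x. F x) = ennreal (1 / p ^ Suc k)"
    using sup[OF bF pos(1) iF] by blast
  obtain q where q: "0 < q" "(SUP x. G x) = ennreal (1 / q ^ Suc k)"
    using sup[OF bG pos(2) iG] by blast
  let ?r = "(p + q) / 2"
  let ?L = "\<lambda>F p t. emeasure lborel {x. ennreal (t * (1 / p ^ Suc k)) \<le> F x} * indicator {0<..<1} (t::real)"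
  have level: "?L F p t + ?L G q t \<le> 2 * ?L H ?r t" for t
  proof (cases "0 < t \<and> t < 1")
    case True
    \<comment> \<open>Absorbing the factor \<open>t\<close> into \<open>p\<close> turns the level \<open>t * sup F\<close> into a threshold of the form
      that occurs in the power mean condition.\<close>
    define s where "s = root (Suc k) t"
    have s: "0 < s" "t = s ^ Suc k"
      using True by (simp_all add: s_def real_root_pow_pos del: power_Suc)
    have t_eq: "t * (1 / p ^ Suc k) = 1 / (p / s) ^ Suc k" for p
      using s by (simp add: power_divide del: power_Suc)
    let ?A = "{x. ennreal (t * (1 / p ^ Suc k)) \<le> F x}"
    let ?B = "{x. ennreal (t * (1 / q ^ Suc k)) \<le> G x}"
    let ?C = "{x. ennreal (t * (1 / ?r ^ Suc k)) \<le> H x}"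
    have ne: "{x. ennreal (t * (1 / p ^ Suc k)) \<le> F x} \<noteq> {}"
      if "0 < p" "(SUP x. F x) = ennreal (1 / p ^ Suc k)" for F :: "real \<Rightarrow> ennreal" and p
    proof -
      have "t * (1 / p ^ Suc k) < 1 * (1 / p ^ Suc k)"
        using True that by (intro mult_strict_right_mono) (auto intro: divide_pos_pos)
      hence "ennreal (t * (1 / p ^ Suc k)) < (SUP x. F x)"
        using True that by (simp add: ennreal_lessI)
      thus ?thesis by (auto simp: less_SUP_iff intro: less_imp_le)
    qed
    have bdd: "bounded {x. ennreal (t * (1 / p ^ Suc k)) \<le> F x}"
      if "0 < p" "\<And>x. F x \<le> ennreal c * indicator {-R..R} x" for F :: "real \<Rightarrow> ennreal" and p
    proof (rule bounded_subset)
      have "0 < t * (1 / p ^ Suc k)" using True that by simp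
      show "{x. ennreal (t * (1 / p ^ Suc k)) \<le> F x} \<subseteq> {-R..R}"
      proof (intro subsetI, rule ccontr)
        fix x assume "x \<in> {x. ennreal (t * (1 / p ^ Suc k)) \<le> F x}" "x \<notin> {-R..R}"
        hence "ennreal (t * (1 / p ^ Suc k)) \<le> 0"
          using that(2)[of x] by (simp del: power_Suc)
        with \<open>0 < t * (1 / p ^ Suc k)\<close> show False by (simp del: power_Suc add: ennreal_eq_0_iff)
      qed
    qed auto
    have "emeasure lborel ?A + emeasure lborel ?B \<le> 2 * emeasure lborel ?C"
    proof (rule brunn_minkowski_line)
      fix x y assume "x \<in> ?A" "y \<in> ?B"
      hence "ennreal (1 / (p / s) ^ Suc k) \<le> F x" "ennreal (1 / (q / s) ^ Suc k) \<le> G y"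
        by (simp_all only: t_eq mem_Collect_eq)
      hence "ennreal (1 / ((p / s + q / s) / 2) ^ Suc k) \<le> H ((x + y) / 2)"
        using mean[of x y] s p q unfolding power_mean_le_def by simp
      also have "(p / s + q / s) / 2 = ?r / s" by (simp add: add_divide_distrib)
      finally show "(x + y) / 2 \<in> ?C" by (simp only: t_eq mem_Collect_eq)
    qed (use ne[OF p] ne[OF q] bdd[OF p(1) bF] bdd[OF q(1) bG] in measurable)
    thus ?thesis using True by simp
  qed simp
  have r: "0 < ?r" using p q by simp
  have layers: "(\<integral>\<^sup>+t. ?L F p t \<partial>lborel) = ennreal (p ^ Suc k) * (\<integral>\<^sup>+x. F x \<partial>lborel)"
    if [measurable]: "F \<in> borel_measurable borel" and "0 < p" "(SUP x. F x) = ennreal (1 / p ^ Suc k)"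
    for F :: "real \<Rightarrow> ennreal" and p
  proof -
    have "F x \<le> ennreal (1 / p ^ Suc k)" for x
      using that by (metis SUP_upper UNIV_I)
    hence "(\<integral>\<^sup>+x. F x \<partial>lborel) = (\<integral>\<^sup>+x. min (F x) (ennreal (1 / p ^ Suc k)) \<partial>lborel)"
      by (simp add: min_absorb1)
    also have "\<dots> = ennreal (1 / p ^ Suc k) * (\<integral>\<^sup>+t. ?L F p t \<partial>lborel)"
      using that by (intro nn_integral_layers) auto
    finally have "ennreal (p ^ Suc k) * (\<integral>\<^sup>+x. F x \<partial>lborel)
        = ennreal (p ^ Suc k * (1 / p ^ Suc k)) * (\<integral>\<^sup>+t. ?L F p t \<partial>lborel)"
      using that by (simp only: ennreal_mult mult.assoc zero_le_power less_imp_le zero_le_divide_1_iff)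
    thus ?thesis using that by simp
  qed
  have mL: "(\<lambda>t. ?L F p t) \<in> borel_measurable borel"
    if [measurable]: "F \<in> borel_measurable borel" for F :: "real \<Rightarrow> ennreal" and p
    by measurable
  have "ennreal (p ^ Suc k / \<alpha> ^ k + q ^ Suc k / \<beta> ^ k)
      = ennreal (p ^ Suc k) * ennreal (1 / \<alpha> ^ k) + ennreal (q ^ Suc k) * ennreal (1 / \<beta> ^ k)"
    using p q pos by (simp add: ennreal_mult[symmetric] ennreal_plus[symmetric] del: ennreal_plus)
  also have "\<dots> \<le> (\<integral>\<^sup>+t. ?L F p t \<partial>lborel) + (\<integral>\<^sup>+t. ?L G q t \<partial>lborel)"
    using iF iG p q by (subst (1 2) layers) (auto intro!: add_mono mult_left_mono)
  also have "\<dots> = (\<integral>\<^sup>+t. ?L F p t + ?L G q t \<partial>lborel)"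
    using mL by (subst nn_integral_add) auto
  also have "\<dots> \<le> (\<integral>\<^sup>+t. 2 * ?L H ?r t \<partial>lborel)"
    by (rule nn_integral_mono) (rule level)
  also have "\<dots> = 2 * (\<integral>\<^sup>+t. ?L H ?r t \<partial>lborel)"
    using mL by (subst nn_integral_cmult) auto
  finally have sum: "ennreal (p ^ Suc k / \<alpha> ^ k + q ^ Suc k / \<beta> ^ k) \<le> 2 * (\<integral>\<^sup>+t. ?L H ?r t \<partial>lborel)" .
  have "ennreal ((p ^ Suc k / \<alpha> ^ k + q ^ Suc k / \<beta> ^ k) / 2)
      = ennreal (1 / 2) * ennreal (p ^ Suc k / \<alpha> ^ k + q ^ Suc k / \<beta> ^ k)"
    using p q pos by (subst ennreal_mult[symmetric]) auto
  also have "\<dots> \<le> ennreal (1 / 2) * (2 * (\<integral>\<^sup>+t. ?L H ?r t \<partial>lborel))"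
    using sum by (rule mult_left_mono) simp
  also have "\<dots> = ennreal (1 / 2 * 2) * (\<integral>\<^sup>+t. ?L H ?r t \<partial>lborel)"
    by (subst ennreal_mult) (auto simp: mult.assoc)
  also have "\<dots> = (\<integral>\<^sup>+t. ?L H ?r t \<partial>lborel)" by simp
  finally have half: "ennreal ((p ^ Suc k / \<alpha> ^ k + q ^ Suc k / \<beta> ^ k) / 2) \<le> (\<integral>\<^sup>+t. ?L H ?r t \<partial>lborel)" .
  have "ennreal (1 / ((\<alpha> + \<beta>) / 2) ^ k)
      \<le> ennreal (1 / ?r ^ Suc k * ((p ^ Suc k / \<alpha> ^ k + q ^ Suc k / \<beta> ^ k) / 2))"
    using perspective_power_convex[OF pos p(1) q(1)] by (rule ennreal_leI)
  also have "\<dots> = ennreal (1 / ?r ^ Suc k) * ennreal ((p ^ Suc k / \<alpha> ^ k + q ^ Suc k / \<beta> ^ k) / 2)"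
    using pos p q by (intro ennreal_mult) auto
  also have "\<dots> \<le> ennreal (1 / ?r ^ Suc k) * (\<integral>\<^sup>+t. ?L H ?r t \<partial>lborel)"
    using half by (rule mult_left_mono) simp
  also have "\<dots> = (\<integral>\<^sup>+x. min (H x) (ennreal (1 / ?r ^ Suc k)) \<partial>lborel)"
    using r by (intro nn_integral_layers[symmetric]) auto
  also have "\<dots> \<le> (\<integral>\<^sup>+x. H x \<partial>lborel)"
    by (rule nn_integral_mono) simp
  finally show "ennreal (1 / ((\<alpha> + \<beta>) / 2) ^ k) \<le> (\<integral>\<^sup>+x. H x \<partial>lborel)" .
qed

section \<open>The Borell--Brascamp--Lieb inequality in Euclidean space\<close>

lemma power_mean_le_mono:
  assumes "power_mean_le k u v w" "u' \<le> u" "v' \<le> v"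
  shows "power_mean_le k u' v' w"
  using assms unfolding power_mean_le_def by (meson order_trans)

lemma power_mean_le_scale:
  assumes "power_mean_le (Suc k) u v w" "0 < t"
  shows "power_mean_le (Suc k) (ennreal t * u) (ennreal t * v) (ennreal t * w)"
  unfolding power_mean_le_def
proof (intro allI impI)
  fix \<alpha> \<beta> :: real
  assume pos: "0 < \<alpha>" "0 < \<beta>" and le: "ennreal (1 / \<alpha> ^ Suc k) \<le> ennreal t * u"
    "ennreal (1 / \<beta> ^ Suc k) \<le> ennreal t * v"
  define s where "s = root (Suc k) t"
  have s: "0 < s" "t = s ^ Suc k"
    using \<open>0 < t\<close> by (simp_all add: s_def real_root_pow_pos del: power_Suc)
  have eq: "ennreal (1 / t) * ennreal (1 / \<alpha> ^ Suc k) = ennreal (1 / (\<alpha> * s) ^ Suc k)" if "0 < \<alpha>" for \<alpha>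
    using that s by (subst ennreal_mult[symmetric]) (auto simp: power_mult_distrib mult_ac simp del: power_Suc)
  have cancel: "ennreal (1 / t) * (ennreal t * u) = u" for u
    using \<open>0 < t\<close> by (simp add: mult.assoc[symmetric] ennreal_mult[symmetric])
  have cancel': "ennreal t * (ennreal (1 / t) * u) = u" for u
    using \<open>0 < t\<close> by (simp add: mult.assoc[symmetric] ennreal_mult[symmetric])
  have "ennreal (1 / (\<alpha> * s) ^ Suc k) \<le> u" "ennreal (1 / (\<beta> * s) ^ Suc k) \<le> v"
    using le[THEN mult_left_mono, of "ennreal (1 / t)"] pos by (simp_all only: eq cancel zero_le)
  hence "ennreal (1 / ((\<alpha> * s + \<beta> * s) / 2) ^ Suc k) \<le> w"
    using assms(1) pos s(1) unfolding power_mean_le_def by simp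
  moreover have "(\<alpha> * s + \<beta> * s) / 2 = (\<alpha> + \<beta>) / 2 * s" by (simp add: algebra_simps)
  ultimately have "ennreal (1 / t) * ennreal (1 / ((\<alpha> + \<beta>) / 2) ^ Suc k) \<le> w"
    using pos by (simp only: eq half_gt_zero_iff add_pos_pos)
  from mult_left_mono[OF this, of "ennreal t"]
  show "ennreal (1 / ((\<alpha> + \<beta>) / 2) ^ Suc k) \<le> ennreal t * w"
    by (simp only: cancel' zero_le)
qed

text \<open>Induction on the number of coordinates. The coordinate \<open>i\<close> is integrated first: for fixed values of the
others the one-dimensional inequality lowers the index of the mean by one, and the induction
hypothesis applies to the partial integrals. The midpoint is quantified over as a separate
variable because coordinates outside \<open>I\<close> carry the default value of extensional functions,
which averaging does not preserve.\<close>

lemma borell_brascamp_lieb_PiM: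
  fixes F G H :: "('i \<Rightarrow> real) \<Rightarrow> ennreal"
  assumes "finite I" "0 \<le> c" "0 \<le> R"
    and "F \<in> borel_measurable (Pi\<^sub>M I (\<lambda>_. lborel))"
      "G \<in> borel_measurable (Pi\<^sub>M I (\<lambda>_. lborel))" "H \<in> borel_measurable (Pi\<^sub>M I (\<lambda>_. lborel))"
    and "\<And>x y z. x \<in> extensional I \<Longrightarrow> y \<in> extensional I \<Longrightarrow> z \<in> extensional I \<Longrightarrow>
       (\<And>i. i \<in> I \<Longrightarrow> z i = (x i + y i) / 2) \<Longrightarrow> power_mean_le (card I + k) (F x) (G y) (H z)"
    and "\<And>x. F x \<le> ennreal c * indicator {x. \<forall>i\<in>I. x i \<in> {-R..R}} x"
    and "\<And>x. G x \<le> ennreal c * indicator {x. \<forall>i\<in>I. x i \<in> {-R..R}} x"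
  shows "power_mean_le k (integral\<^sup>N (Pi\<^sub>M I (\<lambda>_. lborel)) F)
    (integral\<^sup>N (Pi\<^sub>M I (\<lambda>_. lborel)) G) (integral\<^sup>N (Pi\<^sub>M I (\<lambda>_. lborel)) H)"
  using assms
proof (induction I arbitrary: F G H c rule: finite_induct)
  case empty
  interpret product_sigma_finite "\<lambda>_::'i. lborel :: real measure"
    by (rule product_sigma_finite.intro) (rule sigma_finite_lborel)
  have "F \<in> borel_measurable (Pi\<^sub>M {} (\<lambda>_. lborel))" for F :: "('i \<Rightarrow> real) \<Rightarrow> ennreal"
    by (simp add: PiM_empty)
  thus ?case using empty.prems(6)[of "\<lambda>_. undefined" "\<lambda>_. undefined" "\<lambda>_. undefined"]
    by (simp add: nn_integral_empty)
next
  case (insert i I)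
  interpret product_sigma_finite "\<lambda>_::'i. lborel :: real measure"
    by (rule product_sigma_finite.intro) (rule sigma_finite_lborel)
  note [measurable] = insert.prems(3,4,5)
  let ?M = "Pi\<^sub>M I (\<lambda>_. lborel :: real measure)"
  let ?s = "\<lambda>F x. \<integral>\<^sup>+s. F (x(i := s)) \<partial>lborel"
  have meas: "?s F \<in> borel_measurable ?M"
    if [measurable]: "F \<in> borel_measurable (Pi\<^sub>M (insert i I) (\<lambda>_. lborel))" for F :: "('i \<Rightarrow> real) \<Rightarrow> ennreal"
    by measurable
  have sec: "(\<lambda>s. F (x(i := s))) \<in> borel_measurable borel"
    if [measurable]: "F \<in> borel_measurable (Pi\<^sub>M (insert i I) (\<lambda>_. lborel))" and x: "x \<in> extensional I"
    for F :: "('i \<Rightarrow> real) \<Rightarrow> ennreal" and x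
  proof -
    have [measurable]: "x \<in> space ?M" using x by (simp add: space_PiM PiE_def)
    have "(\<lambda>s. F (x(i := s))) \<in> borel_measurable lborel" by measurable
    thus ?thesis by simp
  qed
  have ind: "indicator {x. \<forall>j\<in>insert i I. x j \<in> {-R..R}} (x(i := s))
      = (indicator {x. \<forall>j\<in>I. x j \<in> {-R..R}} x * indicator {-R..R} s :: ennreal)" for x s
    using insert.hyps(2) by (auto split: split_indicator)
  have bound: "?s F x \<le> ennreal (c * (2 * R)) * indicator {x. \<forall>j\<in>I. x j \<in> {-R..R}} x"
    if "\<And>x. F x \<le> ennreal c * indicator {x. \<forall>j\<in>insert i I. x j \<in> {-R..R}} x" for F x
  proof -
    have "?s F x \<le> (\<integral>\<^sup>+s. (ennreal c * indicator {x. \<forall>j\<in>I. x j \<in> {-R..R}} x) * indicator {-R..R} s \<partial>lborel)"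
      using that[of "x(i := _)"] by (intro nn_integral_mono) (simp only: ind mult.assoc)
    also have "\<dots> = (ennreal c * indicator {x. \<forall>j\<in>I. x j \<in> {-R..R}} x) * ennreal (2 * R)"
      using \<open>0 \<le> R\<close> by (subst nn_integral_cmult_indicator) auto
    also have "\<dots> = ennreal (c * (2 * R)) * indicator {x. \<forall>j\<in>I. x j \<in> {-R..R}} x"
      using \<open>0 \<le> R\<close> \<open>0 \<le> c\<close> by (simp add: ennreal_mult mult_ac)
    finally show ?thesis .
  qed
  have "power_mean_le k (integral\<^sup>N ?M (?s F)) (integral\<^sup>N ?M (?s G)) (integral\<^sup>N ?M (?s H))"
  proof (rule insert.IH[where c = "c * (2 * R)"])
    fix x y z :: "'i \<Rightarrow> real"
    assume ext: "x \<in> extensional I" "y \<in> extensional I" "z \<in> extensional I"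
      and mid: "\<And>j. j \<in> I \<Longrightarrow> z j = (x j + y j) / 2"
    show "power_mean_le (card I + k) (?s F x) (?s G y) (?s H z)"
    proof (rule borell_brascamp_lieb_line[where c=c and R=R])
      fix s t :: real
      have "power_mean_le (card (insert i I) + k) (F (x(i := s))) (G (y(i := t))) (H (z(i := (s + t) / 2)))"
        using ext mid by (intro insert.prems(6)) (auto simp: extensional_def)
      thus "power_mean_le (Suc (card I + k)) (F (x(i := s))) (G (y(i := t))) (H (z(i := (s + t) / 2)))"
        using insert.hyps by simp
    next
      fix s
      have le: "ennreal c * indicator {x. \<forall>j\<in>insert i I. x j \<in> {-R..R}} (x(i := s)) \<le> ennreal c * indicator {-R..R} s" for x
        unfolding ind by (intro mult_left_mono) (auto split: split_indicator)
      show "F (x(i := s)) \<le> ennreal c * indicator {-R..R} s"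
        using insert.prems(7) le by (rule order_trans)
      show "G (y(i := s)) \<le> ennreal c * indicator {-R..R} s"
        using insert.prems(8) le by (rule order_trans)
    qed (use sec ext insert.prems(3-5) in auto)
  next
    show "?s F x \<le> ennreal (c * (2 * R)) * indicator {x. \<forall>j\<in>I. x j \<in> {-R..R}} x" for x
      by (rule bound[OF insert.prems(7)])
    show "?s G x \<le> ennreal (c * (2 * R)) * indicator {x. \<forall>j\<in>I. x j \<in> {-R..R}} x" for x
      by (rule bound[OF insert.prems(8)])
  qed (use insert.prems(1,2) in \<open>simp_all only: meas insert.prems(3-5), simp_all\<close>)
  thus ?case
    using insert.hyps insert.prems(3-5) by (simp add: product_nn_integral_insert)
qed

lemma borell_brascamp_lieb_bounded:
  fixes F G H :: "'a::euclidean_space \<Rightarrow> ennreal"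
  assumes [measurable]: "F \<in> borel_measurable borel" "G \<in> borel_measurable borel" "H \<in> borel_measurable borel"
    and mean: "\<And>x y. power_mean_le (DIM('a) + k) (F x) (G y) (H ((1/2) *\<^sub>R (x + y)))"
    and "0 \<le> c" "0 \<le> R"
    and bF: "\<And>x. F x \<le> ennreal c * indicator (cball 0 R) x"
    and bG: "\<And>x. G x \<le> ennreal c * indicator (cball 0 R) x"
  shows "power_mean_le k (\<integral>\<^sup>+x. F x \<partial>lborel) (\<integral>\<^sup>+x. G x \<partial>lborel) (\<integral>\<^sup>+x. H x \<partial>lborel)"
proof -
  let ?P = "Pi\<^sub>M (Basis :: 'a set) (\<lambda>_. lborel :: real measure)"
  let ?e = "\<lambda>f. \<Sum>b\<in>Basis. f b *\<^sub>R b :: 'a"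
  have [measurable]: "?e \<in> ?P \<rightarrow>\<^sub>M borel" by measurable
  have int: "(\<integral>\<^sup>+x. F x \<partial>lborel) = (\<integral>\<^sup>+f. F (?e f) \<partial>?P)"
    if [measurable]: "F \<in> borel_measurable borel" for F :: "'a \<Rightarrow> ennreal"
    by (subst lborel_eq) (simp add: nn_integral_distr)
  have cube: "indicator (cball 0 R) (?e f) \<le> (indicator {f. \<forall>b\<in>Basis. f b \<in> {-R..R}} f :: ennreal)" for f
  proof -
    have "f b \<in> {-R..R}" if "norm (?e f) \<le> R" "b \<in> Basis" for b
    proof -
      have "\<bar>?e f \<bullet> b\<bar> \<le> R" using Basis_le_norm[OF that(2), of "?e f"] that(1) by linarith
      moreover have "?e f \<bullet> b = f b" using that(2) by simp
      ultimately show ?thesis by auto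
    qed
    thus ?thesis by (auto split: split_indicator)
  qed
  show ?thesis
    unfolding int[OF assms(1)] int[OF assms(2)] int[OF assms(3)]
  proof (rule borell_brascamp_lieb_PiM[where c=c and R=R])
    fix x y z :: "'a \<Rightarrow> real"
    assume "\<And>b. b \<in> Basis \<Longrightarrow> z b = (x b + y b) / 2"
    hence "?e z = (1/2) *\<^sub>R (?e x + ?e y)"
      by (simp add: scaleR_add_left sum.distrib scaleR_sum_right add_divide_distrib scaleR_add_right)
    thus "power_mean_le (DIM('a) + k) (F (?e x)) (G (?e y)) (H (?e z))"
      using mean by simp
  next
    show "F (?e x) \<le> ennreal c * indicator {f. \<forall>b\<in>Basis. f b \<in> {-R..R}} x" for x
      using bF by (rule order_trans) (intro mult_left_mono cube, simp)
    show "G (?e x) \<le> ennreal c * indicator {f. \<forall>b\<in>Basis. f b \<in> {-R..R}} x" for x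
      using bG by (rule order_trans) (intro mult_left_mono cube, simp)
  qed (use \<open>0 \<le> c\<close> \<open>0 \<le> R\<close> in auto)
qed

text \<open>General functions are reached by truncating \<open>F\<close> and \<open>G\<close> in height and in space, which only weakens
the hypothesis. The bounded inequality with \<open>k = 0\<close> compares integrals with \<open>1\<close> only; homogeneity
allows comparison with an arbitrary \<open>m\<close> below the minimum.\<close>

lemma borell_brascamp_lieb:
  fixes F G H :: "'a::euclidean_space \<Rightarrow> ennreal"
  assumes [measurable]: "F \<in> borel_measurable borel" "G \<in> borel_measurable borel" "H \<in> borel_measurable borel"
    and mean: "\<And>x y. power_mean_le DIM('a) (F x) (G y) (H ((1/2) *\<^sub>R (x + y)))"
  shows "min (\<integral>\<^sup>+x. F x \<partial>lborel) (\<integral>\<^sup>+x. G x \<partial>lborel) \<le> (\<integral>\<^sup>+x. H x \<partial>lborel)"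
proof (rule dense_le)
  fix m :: ennreal
  assume "m < min (\<integral>\<^sup>+x. F x \<partial>lborel) (\<integral>\<^sup>+x. G x \<partial>lborel)"
  hence m: "m < (\<integral>\<^sup>+x. F x \<partial>lborel)" "m < (\<integral>\<^sup>+x. G x \<partial>lborel)" by auto
  show "m \<le> (\<integral>\<^sup>+x. H x \<partial>lborel)"
  proof (cases "m = 0")
    case False
    obtain r where r: "m = ennreal r" "0 < r"
    proof (cases m)
      case (real r)
      with False that show thesis by (cases "r = 0") auto
    qed (use m in auto)
    define cut where "cut F j x = min (F x) (ennreal (real j)) * indicator (cball 0 (real j)) x"
      for F :: "'a \<Rightarrow> ennreal" and j :: nat and x
    have cut_meas [measurable]: "cut F j \<in> borel_measurable borel"
      if [measurable]: "F \<in> borel_measurable borel" for F j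
    proof -
      have [measurable]: "cball (0::'a) (real j) \<in> sets borel" by simp
      show ?thesis unfolding cut_def by measurable
    qed
    have cut_le: "cut F j x \<le> F x" for F j x
      by (auto simp: cut_def split: split_indicator)
    have cut_mono: "cut F i x \<le> cut F j x" if "i \<le> j" for F i j x
      using that by (auto simp: cut_def le_infI2 min_le_iff_disj ennreal_leI split: split_indicator)
    have cut_SUP: "(SUP j. cut F j x) = F x" for F x
    proof (rule antisym)
      show "(SUP j. cut F j x) \<le> F x" by (intro SUP_least cut_le)
      show "F x \<le> (SUP j. cut F j x)"
      proof (rule dense_le)
        fix u assume "u < F x"
        hence "u < top" using less_top_ennreal by (metis order_less_le_trans top_greatest)
        then obtain v where v: "u = ennreal v" "0 \<le> v" by (cases u) auto
        obtain j :: nat where j: "max v (norm x) \<le> real j" using real_arch_simple by blast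
        hence "u \<le> cut F j x"
          using \<open>u < F x\<close> v by (auto simp: cut_def intro!: ennreal_leI less_imp_le)
        thus "u \<le> (SUP j. cut F j x)" by (rule SUP_upper2[OF UNIV_I])
      qed
    qed
    have ex: "\<exists>j. \<forall>i\<ge>j. m \<le> (\<integral>\<^sup>+x. cut F i x \<partial>lborel)"
      if [measurable]: "F \<in> borel_measurable borel" and lt: "m < (\<integral>\<^sup>+x. F x \<partial>lborel)" for F
    proof -
      have "(\<integral>\<^sup>+x. F x \<partial>lborel) = (\<integral>\<^sup>+x. (SUP j. cut F j x) \<partial>lborel)" by (simp add: cut_SUP)
      also have "\<dots> = (SUP j. \<integral>\<^sup>+x. cut F j x \<partial>lborel)"
        using cut_mono by (intro nn_integral_monotone_convergence_SUP) (auto simp: incseq_def le_fun_def)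
      finally obtain j where j: "m < (\<integral>\<^sup>+x. cut F j x \<partial>lborel)"
        using lt by (auto simp: less_SUP_iff)
      have "m \<le> (\<integral>\<^sup>+x. cut F i x \<partial>lborel)" if "j \<le> i" for i
        using j nn_integral_mono[of lborel "cut F j" "cut F i"] cut_mono[OF that]
        by (meson dual_order.strict_trans1 order_trans less_imp_le)
      thus ?thesis by blast
    qed
    obtain j where j: "m \<le> (\<integral>\<^sup>+x. cut F j x \<partial>lborel)" "m \<le> (\<integral>\<^sup>+x. cut G j x \<partial>lborel)"
      using ex[OF _ m(1)] ex[OF _ m(2)] by (metis assms(1,2) max.cobounded1 max.cobounded2)
    obtain d where d: "DIM('a) = Suc d" by (metis DIM_positive gr0_conv_Suc)
    let ?s = "\<lambda>F x. ennreal (1 / r) * F x"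
    have "power_mean_le 0 (\<integral>\<^sup>+x. ?s (cut F j) x \<partial>lborel) (\<integral>\<^sup>+x. ?s (cut G j) x \<partial>lborel) (\<integral>\<^sup>+x. ?s H x \<partial>lborel)"
    proof (rule borell_brascamp_lieb_bounded[where c = "1 / r * real j" and R = "real j"])
      have "power_mean_le (Suc d) (cut F j x) (cut G j y) (H ((1/2) *\<^sub>R (x + y)))" for x y
        using mean[of x y] cut_le cut_le unfolding d by (rule power_mean_le_mono)
      thus "power_mean_le (DIM('a) + 0) (?s (cut F j) x) (?s (cut G j) y) (?s H ((1/2) *\<^sub>R (x + y)))" for x y
        unfolding d using r power_mean_le_scale[of d] by simp
      have bd: "?s (cut F j) x \<le> ennreal (1 / r * real j) * indicator (cball 0 (real j)) x" for F x
        using r unfolding cut_def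
        by (subst ennreal_mult) (auto simp: mult.assoc intro!: mult_left_mono split: split_indicator)
      show "?s (cut F j) x \<le> ennreal (1 / r * real j) * indicator (cball 0 (real j)) x" for x by (rule bd)
      show "?s (cut G j) x \<le> ennreal (1 / r * real j) * indicator (cball 0 (real j)) x" for x by (rule bd)
    qed (use r in auto)
    hence one: "1 \<le> ennreal (1 / r) * (\<integral>\<^sup>+x. cut F j x \<partial>lborel) \<Longrightarrow>
        1 \<le> ennreal (1 / r) * (\<integral>\<^sup>+x. cut G j x \<partial>lborel) \<Longrightarrow>
        1 \<le> ennreal (1 / r) * (\<integral>\<^sup>+x. H x \<partial>lborel)"
      unfolding power_mean_le_def by (simp add: nn_integral_cmult) (metis zero_less_one)
    have ge: "1 \<le> ennreal (1 / r) * u \<longleftrightarrow> m \<le> u" for u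
    proof -
      have "ennreal r * (ennreal (1 / r) * u) = u" "ennreal (1 / r) * ennreal r = 1"
        using r by (simp_all add: mult.assoc[symmetric] ennreal_mult[symmetric])
      thus ?thesis
        using mult_left_mono[of 1 "ennreal (1 / r) * u" "ennreal r"] mult_left_mono[of m u "ennreal (1 / r)"] r
        by auto
    qed
    show ?thesis using one j by (simp add: ge)
  qed simp
qed

section \<open>Gradients and Hessians\<close>

lemma has_derivative_grad:
  fixes f :: "real^'n \<Rightarrow> real"
  assumes "f differentiable (at x)"
  shows "(f has_derivative (\<lambda>h. grad f x \<bullet> h)) (at x)"
proof -
  let ?D = "frechet_derivative f (at x)"
  have D: "(f has_derivative ?D) (at x)" using assms by (simp add: frechet_derivative_works)
  hence lin: "linear ?D" by (rule has_derivative_linear)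
  have "?D h = grad f x \<bullet> h" for h
  proof -
    have "?D h = ?D (\<Sum>i\<in>UNIV. h $ i *\<^sub>R axis i 1)"
      by (simp add: basis_expansion scalar_mult_eq_scaleR[symmetric])
    also have "\<dots> = (\<Sum>i\<in>UNIV. h $ i * ?D (axis i 1))"
      by (simp add: linear_sum[OF lin] linear_scale[OF lin])
    also have "\<dots> = grad f x \<bullet> h"
      by (simp add: grad_def inner_vec_def mult.commute)
    finally show ?thesis .
  qed
  with D show ?thesis by (metis (no_types, lifting) ext)
qed

lemma has_derivative_hess:
  assumes "C2 V"
  shows "(grad V has_derivative (\<lambda>h. hess V x *v h)) (at x)"
  using assms unfolding C2_def hess_def by (simp add: jacobian_works[symmetric])

lemma has_real_derivative_line:
  fixes f :: "real^'n \<Rightarrow> real"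
  assumes "C1 f"
  shows "((\<lambda>t. f (x + t *\<^sub>R h)) has_real_derivative grad f (x + t *\<^sub>R h) \<bullet> h) (at t)"
proof -
  have "(f has_derivative (\<lambda>h'. grad f (x + t *\<^sub>R h) \<bullet> h')) (at (x + t *\<^sub>R h))"
    using assms by (intro has_derivative_grad) (simp add: C1_def)
  moreover have "((\<lambda>t. x + t *\<^sub>R h) has_derivative (\<lambda>t. t *\<^sub>R h)) (at t)"
    by (auto intro!: derivative_eq_intros)
  ultimately have "((\<lambda>t. f (x + t *\<^sub>R h)) has_derivative (\<lambda>s. grad f (x + t *\<^sub>R h) \<bullet> (s *\<^sub>R h))) (at t)"
    by (rule has_derivative_compose[rotated])
  thus ?thesis by (simp add: has_field_derivative_def mult_commute_abs)
qed

lemma has_real_derivative_grad_line: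
  fixes V :: "real^'n \<Rightarrow> real"
  assumes "C2 V"
  shows "((\<lambda>t. grad V (x + t *\<^sub>R h) \<bullet> k) has_real_derivative (hess V (x + t *\<^sub>R h) *v h) \<bullet> k) (at t)"
proof -
  have "((\<lambda>t. x + t *\<^sub>R h) has_derivative (\<lambda>t. t *\<^sub>R h)) (at t)"
    by (auto intro!: derivative_eq_intros)
  from has_derivative_compose[OF this has_derivative_hess[OF assms]]
  have "((\<lambda>t. grad V (x + t *\<^sub>R h)) has_derivative (\<lambda>s. hess V (x + t *\<^sub>R h) *v (s *\<^sub>R h))) (at t)" .
  from has_derivative_inner_left[OF this, of k]
  have "((\<lambda>t. grad V (x + t *\<^sub>R h) \<bullet> k) has_derivative (\<lambda>s. (hess V (x + t *\<^sub>R h) *v (s *\<^sub>R h)) \<bullet> k)) (at t)" .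
  thus ?thesis by (simp add: has_field_derivative_def mult_commute_abs matrix_vector_mult_scaleR)
qed

lemma mean_value_grad:
  fixes f :: "real^'n \<Rightarrow> real"
  assumes "C1 f"
  obtains t where "0 < t" "t < 1" "f (x + h) = f x + grad f (x + t *\<^sub>R h) \<bullet> h"
proof -
  obtain t where "0 < t" "t < 1" "f (x + 1 *\<^sub>R h) - f (x + 0 *\<^sub>R h) = (1 - 0) * (grad f (x + t *\<^sub>R h) \<bullet> h)"
    using MVT2[of 0 1 "\<lambda>t. f (x + t *\<^sub>R h)" "\<lambda>t. grad f (x + t *\<^sub>R h) \<bullet> h"] has_real_derivative_line[OF assms]
    by auto
  thus thesis by (intro that) auto
qed

lemma taylor_hess:
  fixes V :: "real^'n \<Rightarrow> real"
  assumes "C2 V"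
  obtains t where "0 < t" "t < 1"
    "V (x + h) = V x + grad V x \<bullet> h + (hess V (x + t *\<^sub>R h) *v h) \<bullet> h / 2"
proof -
  have C1: "C1 V" using assms by (simp add: C2_def)
  define d where "d m t = (if m = 0 then V (x + t *\<^sub>R h)
    else if m = 1 then grad V (x + t *\<^sub>R h) \<bullet> h else (hess V (x + t *\<^sub>R h) *v h) \<bullet> h)" for m :: nat and t :: real
  have d_Suc: "DERIV (d m) t :> d (Suc m) t" if "m < 2" for m t
  proof (cases "m = 0")
    case True
    have "d 0 = (\<lambda>t. V (x + t *\<^sub>R h))" by (simp add: d_def fun_eq_iff)
    thus ?thesis using has_real_derivative_line[OF C1] True by (simp add: d_def)
  next
    case False
    hence m: "m = 1" using that by auto
    have "d 1 = (\<lambda>t. grad V (x + t *\<^sub>R h) \<bullet> h)" by (simp add: d_def fun_eq_iff)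
    thus ?thesis using has_real_derivative_grad_line[OF assms] m by (simp add: d_def)
  qed
  obtain t where "0 < t" "t < 1" "d 0 1 = (\<Sum>m<2. (d m 0 / fact m) * (1 - 0) ^ m) + (d 2 t / fact 2) * (1 - 0) ^ 2"
    using Taylor_up[of 2 d "d 0" 0 1 0] d_Suc by auto
  thus thesis by (intro that) (auto simp: d_def eval_nat_numeral)
qed

lemma continuous_on_matrix_vector_mult:
  fixes A :: "'a::topological_space \<Rightarrow> real^'n^'m"
  assumes "continuous_on S A" "continuous_on S b"
  shows "continuous_on S (\<lambda>x. A x *v b x)"
  unfolding matrix_vector_mult_def by (intro continuous_intros continuous_on_vec_lambda assms)

text \<open>The mean value theorem first in the direction \<open>v\<close>, then in the direction \<open>u\<close>. The left-hand side is
symmetric in \<open>u\<close> and \<open>v\<close>, which is the source of the symmetry of the Hessian.\<close>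

lemma hess_mixed_difference:
  fixes V :: "real^'n \<Rightarrow> real"
  assumes "C2 V" "0 < s"
  obtains p q where "0 < p" "p < s" "0 < q" "q < s"
    "V (x + s *\<^sub>R u + s *\<^sub>R v) - V (x + s *\<^sub>R u) - V (x + s *\<^sub>R v) + V x
      = s * (s * ((hess V (x + p *\<^sub>R u + q *\<^sub>R v) *v u) \<bullet> v))"
proof -
  have C1: "C1 V" using assms by (simp add: C2_def)
  have D: "((\<lambda>t. V ((x + s *\<^sub>R u) + t *\<^sub>R v) - V (x + t *\<^sub>R v)) has_real_derivative
      grad V ((x + s *\<^sub>R u) + t *\<^sub>R v) \<bullet> v - grad V (x + t *\<^sub>R v) \<bullet> v) (at t)" for t
    by (intro DERIV_diff has_real_derivative_line C1)
  obtain q where q: "0 < q" "q < s"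
    "V ((x + s *\<^sub>R u) + s *\<^sub>R v) - V (x + s *\<^sub>R v) - (V ((x + s *\<^sub>R u) + 0 *\<^sub>R v) - V (x + 0 *\<^sub>R v))
     = (s - 0) * (grad V ((x + s *\<^sub>R u) + q *\<^sub>R v) \<bullet> v - grad V (x + q *\<^sub>R v) \<bullet> v)"
    using MVT2[OF \<open>0 < s\<close> D] by auto
  obtain p where p: "0 < p" "p < s"
    "grad V ((x + q *\<^sub>R v) + s *\<^sub>R u) \<bullet> v - grad V ((x + q *\<^sub>R v) + 0 *\<^sub>R u) \<bullet> v
     = (s - 0) * ((hess V ((x + q *\<^sub>R v) + p *\<^sub>R u) *v u) \<bullet> v)"
    using MVT2[OF \<open>0 < s\<close> has_real_derivative_grad_line[OF assms(1)]] by meson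
  show thesis
    using p q by (intro that[of p q]) (auto simp: add_ac)
qed

text \<open>Schwarz's theorem: both orders of differentiation evaluate the same mixed difference, at points that
tend to \<open>x\<close> together with the step size \<open>s\<close>.\<close>

lemma hess_symmetric:
  fixes V :: "real^'n \<Rightarrow> real"
  assumes "C2 V"
  shows "(hess V x *v u) \<bullet> v = (hess V x *v v) \<bullet> u"
proof (rule ccontr)
  assume ne: "(hess V x *v u) \<bullet> v \<noteq> (hess V x *v v) \<bullet> u"
  define e where "e = \<bar>(hess V x *v u) \<bullet> v - (hess V x *v v) \<bullet> u\<bar> / 2"
  have "0 < e" using ne by (simp add: e_def)
  have cont: "continuous_on UNIV (hess V)" using assms by (simp add: C2_def)
  have near: "\<exists>s0>0. \<forall>s p q. 0 < p \<and> p < s \<and> 0 < q \<and> q < s \<and> s < s0 \<longrightarrow>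
     \<bar>(hess V (x + p *\<^sub>R u + q *\<^sub>R v) *v u) \<bullet> v - (hess V x *v u) \<bullet> v\<bar> < e" for u v
  proof -
    have "continuous_on UNIV (\<lambda>y. (hess V y *v u) \<bullet> v)"
      by (intro continuous_intros continuous_on_matrix_vector_mult cont)
    hence "isCont (\<lambda>y. (hess V y *v u) \<bullet> v) x" by (simp add: continuous_on_eq_continuous_at)
    then obtain d where d: "0 < d" "\<And>y. norm (y - x) < d \<Longrightarrow> \<bar>(hess V y *v u) \<bullet> v - (hess V x *v u) \<bullet> v\<bar> < e"
      using \<open>0 < e\<close> unfolding continuous_at_eps_delta dist_norm by force
    have "norm (x + p *\<^sub>R u + q *\<^sub>R v - x) < d"
      if "0 < p" "p < s" "0 < q" "q < s" "s < d / (norm u + norm v + 1)" for s p q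
    proof -
      have "norm (x + p *\<^sub>R u + q *\<^sub>R v - x) \<le> p * norm u + q * norm v"
        using that norm_triangle_ineq[of "p *\<^sub>R u" "q *\<^sub>R v"] by simp
      also have "\<dots> \<le> s * norm u + s * norm v" using that by (intro add_mono mult_right_mono) auto
      also have "\<dots> \<le> s * (norm u + norm v + 1)" using that by (simp add: algebra_simps)
      also have "\<dots> < d"
        using that(5) by (simp add: pos_less_divide_eq add_nonneg_pos)
      finally show ?thesis .
    qed
    thus ?thesis using d by (intro exI[of _ "d / (norm u + norm v + 1)"]) (auto simp: add_nonneg_pos)
  qed
  obtain s1 where s1: "0 < s1" "\<And>s p q. 0 < p \<Longrightarrow> p < s \<Longrightarrow> 0 < q \<Longrightarrow> q < s \<Longrightarrow> s < s1 \<Longrightarrow>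
     \<bar>(hess V (x + p *\<^sub>R u + q *\<^sub>R v) *v u) \<bullet> v - (hess V x *v u) \<bullet> v\<bar> < e" using near[of u v] by blast
  obtain s2 where s2: "0 < s2" "\<And>s p q. 0 < p \<Longrightarrow> p < s \<Longrightarrow> 0 < q \<Longrightarrow> q < s \<Longrightarrow> s < s2 \<Longrightarrow>
     \<bar>(hess V (x + p *\<^sub>R v + q *\<^sub>R u) *v v) \<bullet> u - (hess V x *v v) \<bullet> u\<bar> < e" using near[of v u] by blast
  define s where "s = min s1 s2 / 2"
  have s: "0 < s" "s < s1" "s < s2" using s1 s2 by (auto simp: s_def)
  obtain p q where pq: "0 < p" "p < s" "0 < q" "q < s"
    "V (x + s *\<^sub>R u + s *\<^sub>R v) - V (x + s *\<^sub>R u) - V (x + s *\<^sub>R v) + V x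
      = s * (s * ((hess V (x + p *\<^sub>R u + q *\<^sub>R v) *v u) \<bullet> v))" by (rule hess_mixed_difference[OF assms s(1)])
  obtain p' q' where pq': "0 < p'" "p' < s" "0 < q'" "q' < s"
    "V (x + s *\<^sub>R v + s *\<^sub>R u) - V (x + s *\<^sub>R v) - V (x + s *\<^sub>R u) + V x
      = s * (s * ((hess V (x + p' *\<^sub>R v + q' *\<^sub>R u) *v v) \<bullet> u))" by (rule hess_mixed_difference[OF assms s(1)])
  have "x + s *\<^sub>R v + s *\<^sub>R u = x + s *\<^sub>R u + s *\<^sub>R v" by simp
  hence "s * (s * ((hess V (x + p *\<^sub>R u + q *\<^sub>R v) *v u) \<bullet> v))
      = s * (s * ((hess V (x + p' *\<^sub>R v + q' *\<^sub>R u) *v v) \<bullet> u))"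
    using pq(5) pq'(5) by (simp only:)
  hence "(hess V (x + p *\<^sub>R u + q *\<^sub>R v) *v u) \<bullet> v = (hess V (x + p' *\<^sub>R v + q' *\<^sub>R u) *v v) \<bullet> u"
    using s by simp
  with s1(2)[OF pq(1-4) s(2)] s2(2)[OF pq'(1-4) s(3)] show False
    by (simp add: e_def abs_if split: if_splits)
qed

section \<open>The dimensional Brascamp--Lieb density\<close>

lemma pos_def_invertible:
  fixes A :: "real^'n^'n"
  assumes "pos_def A" shows "invertible A"
proof -
  have "A *v x = 0 \<Longrightarrow> x = 0" for x
    using assms unfolding pos_def_def by (metis inner_zero_right less_irrefl)
  thus ?thesis
    by (simp add: invertible_left_inverse matrix_left_invertible_ker)
qed

lemma matrix_inv_solves:
  fixes A :: "real^'n^'n"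
  assumes "invertible A" shows "A *v (matrix_inv A *v b) = b"
proof -
  have "A ** matrix_inv A = mat 1"
    using assms unfolding invertible_def matrix_inv_def by (rule someI2_ex) auto
  thus ?thesis by (simp add: matrix_vector_mul_assoc)
qed

text \<open>Cramer's rule writes the inverse through determinants, whose continuity in the entries is evident.\<close>

lemma matrix_inv_cramer:
  fixes A :: "real^'n^'n"
  assumes "invertible A"
  shows "matrix_inv A *v b = (\<chi> k. det (\<chi> i j. if j = k then b $ i else A $ i $ j) / det A)"
  using cramer[of A "matrix_inv A *v b" b] matrix_inv_solves[OF assms] assms
  by (simp add: invertible_det_nz)

lemma continuous_on_det:
  fixes A :: "'a::topological_space \<Rightarrow> real^'n^'n"
  assumes "\<And>i j. continuous_on S (\<lambda>x. A x $ i $ j)"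
  shows "continuous_on S (\<lambda>x. det (A x))"
  unfolding det_def by (intro continuous_intros assms)

lemma continuous_on_matrix_inv_vector:
  fixes A :: "'a::topological_space \<Rightarrow> real^'n^'n"
  assumes "continuous_on S A" "continuous_on S b" "\<And>x. x \<in> S \<Longrightarrow> invertible (A x)"
  shows "continuous_on S (\<lambda>x. matrix_inv (A x) *v b x)"
proof -
  have "continuous_on S (\<lambda>x. det (\<chi> i j. if j = k then b x $ i else A x $ i $ j))" for k
  proof (rule continuous_on_det)
    fix i j
    show "continuous_on S (\<lambda>x. (\<chi> i j. if j = k then b x $ i else A x $ i $ j) $ i $ j)"
      by (cases "j = k") (auto intro!: continuous_intros assms)
  qed
  moreover have "continuous_on S (\<lambda>x. det (A x))"
    by (rule continuous_on_det) (intro continuous_intros assms)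
  ultimately have "continuous_on S (\<lambda>x. \<chi> k. det (\<chi> i j. if j = k then b x $ i else A x $ i $ j) / det (A x))"
    using assms(3) by (intro continuous_on_vec_lambda continuous_on_divide) (auto simp: invertible_det_nz)
  thus ?thesis
    by (rule continuous_on_eq) (simp add: matrix_inv_cramer assms(3))
qed

text \<open>The pointwise integrand of the right-hand side, with \<open>A\<close>, \<open>b\<close>, \<open>g\<close>, \<open>a\<close> standing for \<open>Hess V\<close>, \<open>\<nabla>V\<close>, \<open>\<nabla>f\<close>
and \<open>f\<close>, and \<open>N\<close> for the dimension.\<close>

definition bl_density :: "real \<Rightarrow> real^'n^'n \<Rightarrow> real^'n \<Rightarrow> real^'n \<Rightarrow> real \<Rightarrow> real" where
  "bl_density N A b g a = g \<bullet> (matrix_inv A *v g)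
     - (a - g \<bullet> (matrix_inv A *v b))\<^sup>2 / (N + b \<bullet> (matrix_inv A *v b))"

lemma pos_def_inv_nonneg:
  fixes A :: "real^'n^'n"
  assumes "pos_def A"
  shows "0 \<le> b \<bullet> (matrix_inv A *v b)"
proof -
  let ?x = "matrix_inv A *v b"
  have "b \<bullet> ?x = ?x \<bullet> (A *v ?x)"
    using matrix_inv_solves[OF pos_def_invertible[OF assms]] by (simp add: inner_commute)
  also have "\<dots> \<ge> 0" using assms unfolding pos_def_def by (cases "?x = 0") (auto simp: less_imp_le)
  finally show ?thesis .
qed

text \<open>The density is the least coefficient of \<open>s\<^sup>2\<close> for which this form in \<open>(h, s)\<close> is nonnegative.
The substitution \<open>z = h + s A\<inverse> g\<close> removes the cross term and leaves
\<open>z \<bullet> A z + (b \<bullet> z + s c)\<^sup>2 / N\<close> with \<open>c = a - g \<bullet> A\<inverse> b\<close>. Both squares are bounded below by their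
tangents, for a common multiplier \<open>\<tau>\<close>, such that the terms linear in \<open>z\<close> cancel.\<close>

lemma bl_density_quadratic_nonneg:
  fixes A :: "real^'n^'n"
  assumes pd: "pos_def A" and sym: "\<And>u v. (A *v u) \<bullet> v = (A *v v) \<bullet> u" and "0 < N"
  shows "0 \<le> h \<bullet> (A *v h) + 2 * s * (g \<bullet> h) + (b \<bullet> h + s * a)\<^sup>2 / N + s\<^sup>2 * bl_density N A b g a"
proof -
  let ?P = "\<lambda>v. matrix_inv A *v v"
  have inv: "A *v (?P v) = v" for v by (rule matrix_inv_solves[OF pos_def_invertible[OF pd]])
  have nonneg: "0 \<le> v \<bullet> (A *v v)" for v
    using pd unfolding pos_def_def by (cases "v = 0") (auto simp: less_imp_le)
  have gb: "g \<bullet> ?P b = b \<bullet> ?P g"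
    using sym[of "?P g" "?P b"] by (simp add: inv)
  define z where "z = h + s *\<^sub>R ?P g"
  define c where "c = a - g \<bullet> ?P b"
  define B where "B = b \<bullet> ?P b"
  have B: "0 \<le> B" unfolding B_def by (rule pos_def_inv_nonneg[OF pd])
  \<comment> \<open>The value of \<open>\<tau>\<close> that maximises the lower bound \<open>2 * \<tau> * (s * c) - \<tau>\<^sup>2 * (N + B)\<close>.\<close>
  define \<tau> where "\<tau> = s * c / (N + B)"
  have shift: "(u + r *\<^sub>R ?P v) \<bullet> (A *v (u + r *\<^sub>R ?P v)) = u \<bullet> (A *v u) + 2 * r * (v \<bullet> u) + r\<^sup>2 * (v \<bullet> ?P v)" for u v r
    using sym[of u "?P v"]
    by (simp add: inv matrix_vector_right_distrib matrix_vector_mult_scaleR inner_add_left inner_add_right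
        inner_commute power2_eq_square algebra_simps)
  have e1: "h \<bullet> (A *v h) + 2 * s * (g \<bullet> h) = z \<bullet> (A *v z) - s\<^sup>2 * (g \<bullet> ?P g)"
    using shift[of h s g] by (simp add: z_def)
  have e2: "b \<bullet> h + s * a = b \<bullet> z + s * c"
    by (simp add: z_def c_def gb inner_add_right algebra_simps)
  have e3: "0 \<le> z \<bullet> (A *v z) + 2 * \<tau> * (b \<bullet> z) + \<tau>\<^sup>2 * B"
    using nonneg[of "z + \<tau> *\<^sub>R ?P b"] shift[of z \<tau> b] by (simp add: B_def)
  have e4: "0 \<le> (b \<bullet> z + s * c - N * \<tau>)\<^sup>2 / N" using \<open>0 < N\<close> by simp
  have e5: "(b \<bullet> z + s * c - N * \<tau>)\<^sup>2 / N = (b \<bullet> z + s * c)\<^sup>2 / N - 2 * \<tau> * (b \<bullet> z + s * c) + N * \<tau>\<^sup>2"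
    using \<open>0 < N\<close> by (simp add: power2_eq_square field_simps)
  have e6: "2 * \<tau> * (s * c) - \<tau>\<^sup>2 * B - N * \<tau>\<^sup>2 = s\<^sup>2 * (c\<^sup>2 / (N + B))"
  proof -
    have "\<tau> * (N + B) = s * c" using \<open>0 < N\<close> B by (simp add: \<tau>_def)
    hence "\<tau>\<^sup>2 * B + N * \<tau>\<^sup>2 = \<tau> * (s * c)" by (metis (no_types) power2_eq_square mult.assoc mult.commute distrib_left add.commute)
    moreover have "\<tau> * (s * c) = s\<^sup>2 * (c\<^sup>2 / (N + B))" by (simp add: \<tau>_def power2_eq_square)
    ultimately show ?thesis by simp
  qed
  have e7: "bl_density N A b g a = g \<bullet> ?P g - c\<^sup>2 / (N + B)"
    by (simp add: bl_density_def c_def B_def)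
  have "s\<^sup>2 * bl_density N A b g a = s\<^sup>2 * (g \<bullet> ?P g) - s\<^sup>2 * (c\<^sup>2 / (N + B))"
    by (simp add: e7 right_diff_distrib)
  moreover have "2 * \<tau> * (b \<bullet> z + s * c) = 2 * \<tau> * (b \<bullet> z) + 2 * \<tau> * (s * c)"
    by (simp add: algebra_simps)
  ultimately show ?thesis
    using e1 e3 e4 e5 e6 unfolding e2 by linarith
qed

section \<open>Expansions that are uniform on compact sets\<close>

lemma continuous_on_compact_uniform:
  fixes g :: "real^'n \<Rightarrow> 'b::real_normed_vector"
  assumes "continuous_on UNIV g" "compact S" "0 < e"
  obtains d where "0 < d" "\<And>z w. z \<in> S \<Longrightarrow> norm w < d \<Longrightarrow> norm (g (z + w) - g z) < e"
proof -
  let ?K = "{x + y |x y. x \<in> S \<and> y \<in> cball 0 1}"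
  have "compact ?K" using assms(2) by (intro compact_sums) auto
  hence "uniformly_continuous_on ?K g"
    using assms(1) by (intro compact_uniformly_continuous) (auto intro: continuous_on_subset)
  then obtain d where d: "0 < d" "\<And>x y. x \<in> ?K \<Longrightarrow> y \<in> ?K \<Longrightarrow> dist y x < d \<Longrightarrow> dist (g y) (g x) < e"
    using \<open>0 < e\<close> unfolding uniformly_continuous_on_def by meson
  show thesis
  proof (rule that[of "min d 1"])
    fix z w :: "real^'n" assume zw: "z \<in> S" "norm w < min d 1"
    have "z + 0 \<in> ?K" using zw(1) by (intro CollectI exI conjI) auto
    hence "z \<in> ?K" by simp
    moreover have "z + w \<in> ?K" using zw by (intro CollectI exI conjI) auto
    ultimately have "dist (g (z + w)) (g z) < e"
      using zw by (intro d(2)) (auto simp: dist_norm)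
    thus "norm (g (z + w) - g z) < e" by (simp add: dist_norm)
  qed (use d in auto)
qed

lemma norm_matrix_vector_le:
  fixes A :: "real^'n^'m"
  shows "norm (A *v v) \<le> norm A * norm v"
proof -
  have "norm (A *v v) = L2_set (\<lambda>i. norm ((A *v v) $ i)) UNIV" by (simp add: norm_vec_def)
  also have "\<dots> \<le> L2_set (\<lambda>i. norm (A $ i) * norm v) UNIV"
    by (intro L2_set_mono) (auto simp: matrix_vector_mul_component Cauchy_Schwarz_ineq2)
  also have "\<dots> = norm A * norm v"
    by (simp add: L2_set_left_distrib norm_vec_def)
  finally show ?thesis .
qed

text \<open>Expansions are functions of \<open>(z, (h, s))\<close>: a base point, a displacement and the size of the perturbation.\<close>

abbreviation center :: "'a \<times> ('a \<times> real) \<Rightarrow> 'a" where "center \<equiv> fst"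
abbreviation shift :: "'a \<times> ('a \<times> real) \<Rightarrow> 'a" where "shift x \<equiv> fst (snd x)"
abbreviation param :: "'a \<times> ('a \<times> real) \<Rightarrow> real" where "param x \<equiv> snd (snd x)"

text \<open>Convergence \<open>(h, s) \<rightarrow> 0\<close> uniformly in \<open>z \<in> S\<close>, as a filter, so that Landau symbols along it express
uniform remainder estimates.\<close>

definition near :: "(real^'n) set \<Rightarrow> ((real^'n) \<times> ((real^'n) \<times> real)) filter" where
  "near S = principal S \<times>\<^sub>F nhds 0"

lemma eventually_near:
  "eventually P (near S) \<longleftrightarrow> (\<exists>d>0. \<forall>z\<in>S. \<forall>p. norm p < d \<longrightarrow> P (z, p))"
proof
  assume "eventually P (near S)"
  then obtain Q R where "\<forall>z\<in>S. Q z" "eventually R (nhds 0)" "\<And>z p. Q z \<Longrightarrow> R p \<Longrightarrow> P (z, p)"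
    unfolding near_def eventually_prod_filter eventually_principal by blast
  thus "\<exists>d>0. \<forall>z\<in>S. \<forall>p. norm p < d \<longrightarrow> P (z, p)"
    unfolding eventually_nhds_metric by (metis dist_0_norm dist_commute)
next
  assume "\<exists>d>0. \<forall>z\<in>S. \<forall>p. norm p < d \<longrightarrow> P (z, p)"
  then obtain d where d: "d > 0" "\<forall>z\<in>S. \<forall>p. norm p < d \<longrightarrow> P (z, p)" by blast
  have "eventually (\<lambda>p. norm p < d) (nhds (0 :: (real^'a) \<times> real))"
    using d(1) unfolding eventually_nhds_metric by (auto simp: dist_norm)
  with d(2) show "eventually P (near S)"
    unfolding near_def eventually_prod_filter eventually_principal by blast
qed

lemma shift_bigo: "(\<lambda>x. norm (shift x)) \<in> O[near S](\<lambda>x. norm (snd x))"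
  by (rule landau_o.bigI[of 1]) (auto intro!: always_eventually norm_fst_le simp: case_prod_beta)

lemma param_bigo: "param \<in> O[near S](\<lambda>x. norm (snd x))"
proof (rule landau_o.bigI[of 1])
  have "\<bar>s\<bar> \<le> norm (h, s)" for h :: "real^'n" and s :: real
    using norm_snd_le[of s h] by simp
  thus "\<forall>\<^sub>F x in near S. norm (param x) \<le> 1 * norm (norm (snd x))"
    by (auto intro!: always_eventually)
qed simp

lemma bigo_one_center:
  fixes g :: "real^'n \<Rightarrow> 'b::real_normed_vector"
  assumes "compact S" "continuous_on UNIV g"
  shows "(\<lambda>x. norm (g (center x))) \<in> O[near S](\<lambda>_. 1)"
proof -
  have "bounded (g ` S)"
    using assms by (intro compact_imp_bounded compact_continuous_image) (auto intro: continuous_on_subset)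
  then obtain B where "\<And>z. z \<in> S \<Longrightarrow> norm (g z) \<le> B" by (auto simp: bounded_iff)
  thus ?thesis by (intro landau_o.big_mono bigoI[of _ B]) (auto simp: eventually_near intro!: exI[of _ 1])
qed

lemma C2_imp_C1: "C2 V \<Longrightarrow> C1 V" by (simp add: C2_def)

lemma C1_continuous: "C1 f \<Longrightarrow> continuous_on UNIV f"
  unfolding C1_def by (meson continuous_at_imp_continuous_on differentiable_imp_continuous_within)

lemma first_order_smallo:
  fixes f :: "real^'n \<Rightarrow> real"
  assumes "C1 f" "compact S" "\<bar>\<sigma>\<bar> = 1"
  shows "(\<lambda>x. f (center x + \<sigma> *\<^sub>R shift x) - f (center x) - \<sigma> * (grad f (center x) \<bullet> shift x))
    \<in> o[near S](\<lambda>x. norm (snd x))"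
proof (rule landau_o.smallI)
  fix c :: real assume "0 < c"
  have "continuous_on UNIV (grad f)" using assms(1) by (simp add: C1_def)
  then obtain d where d: "0 < d" "\<And>z w. z \<in> S \<Longrightarrow> norm w < d \<Longrightarrow> norm (grad f (z + w) - grad f z) < c"
    using continuous_on_compact_uniform[OF _ assms(2) \<open>0 < c\<close>] by metis
  have "\<bar>f (z + \<sigma> *\<^sub>R h) - f z - \<sigma> * (grad f z \<bullet> h)\<bar> \<le> c * norm (h, s)"
    if "z \<in> S" "norm (h, s) < d" for z h s
  proof -
    obtain t where t: "0 < t" "t < 1" "f (z + \<sigma> *\<^sub>R h) = f z + grad f (z + t *\<^sub>R \<sigma> *\<^sub>R h) \<bullet> \<sigma> *\<^sub>R h"
      by (rule mean_value_grad[OF assms(1)])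
    have h: "norm h \<le> norm (h, s)" by (rule norm_fst_le)
    have "norm (t *\<^sub>R \<sigma> *\<^sub>R h) \<le> norm h" using t assms(3) by (simp add: abs_mult mult_left_le_one_le)
    hence "norm (t *\<^sub>R \<sigma> *\<^sub>R h) < d" using h that by linarith
    hence *: "norm (grad f (z + t *\<^sub>R \<sigma> *\<^sub>R h) - grad f z) \<le> c" using d(2)[OF that(1)] by (simp add: less_imp_le)
    have "\<bar>f (z + \<sigma> *\<^sub>R h) - f z - \<sigma> * (grad f z \<bullet> h)\<bar> = \<bar>(grad f (z + t *\<^sub>R \<sigma> *\<^sub>R h) - grad f z) \<bullet> (\<sigma> *\<^sub>R h)\<bar>"
      using t(3) by (simp add: inner_diff_left algebra_simps)
    also have "\<dots> \<le> norm (grad f (z + t *\<^sub>R \<sigma> *\<^sub>R h) - grad f z) * norm (\<sigma> *\<^sub>R h)"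
      by (rule Cauchy_Schwarz_ineq2)
    also have "\<dots> \<le> c * norm (h, s)"
      using * h assms(3) \<open>0 < c\<close> by (intro mult_mono) auto
    finally show ?thesis .
  qed
  thus "\<forall>\<^sub>F x in near S. norm (f (center x + \<sigma> *\<^sub>R shift x) - f (center x) - \<sigma> * (grad f (center x) \<bullet> shift x))
      \<le> c * norm (norm (snd x))"
    unfolding eventually_near using d(1) by auto
qed

lemma second_order_smallo:
  fixes V :: "real^'n \<Rightarrow> real"
  assumes "C2 V" "compact S" "\<bar>\<sigma>\<bar> = 1"
  shows "(\<lambda>x. V (center x + \<sigma> *\<^sub>R shift x) - V (center x) - \<sigma> * (grad V (center x) \<bullet> shift x)
      - (shift x \<bullet> (hess V (center x) *v shift x)) / 2) \<in> o[near S](\<lambda>x. (norm (snd x))\<^sup>2)"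
proof (rule landau_o.smallI)
  fix c :: real assume "0 < c"
  have "continuous_on UNIV (hess V)" using assms(1) by (simp add: C2_def)
  then obtain d where d: "0 < d" "\<And>z w. z \<in> S \<Longrightarrow> norm w < d \<Longrightarrow> norm (hess V (z + w) - hess V z) < c"
    using continuous_on_compact_uniform[OF _ assms(2) \<open>0 < c\<close>] by metis
  have "\<bar>V (z + \<sigma> *\<^sub>R h) - V z - \<sigma> * (grad V z \<bullet> h) - (h \<bullet> (hess V z *v h)) / 2\<bar> \<le> c * (norm (h, s))\<^sup>2"
    if "z \<in> S" "norm (h, s) < d" for z h s
  proof -
    obtain t where t: "0 < t" "t < 1" "V (z + \<sigma> *\<^sub>R h) = V z + grad V z \<bullet> \<sigma> *\<^sub>R h
        + (hess V (z + t *\<^sub>R \<sigma> *\<^sub>R h) *v \<sigma> *\<^sub>R h) \<bullet> \<sigma> *\<^sub>R h / 2"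
      by (rule taylor_hess[OF assms(1)])
    let ?D = "hess V (z + t *\<^sub>R \<sigma> *\<^sub>R h) - hess V z"
    have h: "norm h \<le> norm (h, s)" by (rule norm_fst_le)
    have "norm (t *\<^sub>R \<sigma> *\<^sub>R h) \<le> norm h" using t assms(3) by (simp add: abs_mult mult_left_le_one_le)
    hence "norm (t *\<^sub>R \<sigma> *\<^sub>R h) < d" using h that by linarith
    hence *: "norm ?D \<le> c" using d(2)[OF that(1)] by (simp add: less_imp_le)
    have "\<sigma> * \<sigma> = 1" using assms(3) by (metis abs_mult_self_eq mult_1)
    hence "\<bar>V (z + \<sigma> *\<^sub>R h) - V z - \<sigma> * (grad V z \<bullet> h) - (h \<bullet> (hess V z *v h)) / 2\<bar> = \<bar>(?D *v h) \<bullet> h\<bar> / 2"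
    proof -
      have "(?D *v h) \<bullet> h = (hess V (z + t *\<^sub>R \<sigma> *\<^sub>R h) *v h) \<bullet> h - h \<bullet> (hess V z *v h)"
        by (simp add: matrix_vector_mult_diff_rdistrib inner_diff_left inner_diff_right inner_commute)
      moreover have "V (z + \<sigma> *\<^sub>R h) = V z + \<sigma> * (grad V z \<bullet> h) + (hess V (z + t *\<^sub>R \<sigma> *\<^sub>R h) *v h) \<bullet> h / 2"
        using t(3) \<open>\<sigma> * \<sigma> = 1\<close> by (simp add: matrix_vector_mult_scaleR mult.assoc[symmetric])
      ultimately have "V (z + \<sigma> *\<^sub>R h) - V z - \<sigma> * (grad V z \<bullet> h) - (h \<bullet> (hess V z *v h)) / 2 = ((?D *v h) \<bullet> h) / 2"
        by simp
      thus ?thesis by (simp only: abs_divide abs_numeral)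
    qed
    also have "\<dots> \<le> (norm (?D *v h) * norm h) / 2" by (intro divide_right_mono Cauchy_Schwarz_ineq2) simp
    also have "\<dots> \<le> ((c * norm (h, s)) * norm (h, s)) / 2"
      using * h \<open>0 < c\<close> by (intro divide_right_mono mult_mono order_trans[OF norm_matrix_vector_le]) auto
    also have "\<dots> \<le> c * (norm (h, s))\<^sup>2" using \<open>0 < c\<close> by (simp add: power2_eq_square)
    finally show ?thesis .
  qed
  thus "\<forall>\<^sub>F x in near S. norm (V (center x + \<sigma> *\<^sub>R shift x) - V (center x) - \<sigma> * (grad V (center x) \<bullet> shift x)
      - (shift x \<bullet> (hess V (center x) *v shift x)) / 2) \<le> c * norm ((norm (snd x))\<^sup>2)"
    unfolding eventually_near using d(1) by auto
qed

lemma exp_third_order: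
  assumes "\<bar>x\<bar> \<le> 1" shows "\<bar>exp x - (1 + x + x\<^sup>2 / 2)\<bar> \<le> \<bar>x::real\<bar> ^ 3"
proof -
  obtain t where t: "\<bar>t\<bar> \<le> \<bar>x\<bar>" "exp x = (\<Sum>m<3. x ^ m / fact m) + exp t / fact 3 * x ^ 3"
    using Maclaurin_exp_le by blast
  have "exp t \<le> exp 1" using t assms by simp
  also have "exp (1::real) \<le> 3" by (rule exp_le)
  finally have "exp t / 6 * \<bar>x\<bar> ^ 3 \<le> 1 * \<bar>x\<bar> ^ 3" by (intro mult_right_mono) auto
  thus ?thesis using t(2) by (simp add: eval_nat_numeral abs_mult)
qed

lemma exp_second_order:
  assumes "\<bar>x\<bar> \<le> 1" shows "\<bar>exp x - (1 + x)\<bar> \<le> 2 * (x::real)\<^sup>2"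
proof -
  have "\<bar>x\<bar> ^ 3 \<le> x\<^sup>2" using assms power_decreasing[of 2 3 "\<bar>x\<bar>"] by simp
  thus ?thesis using exp_third_order[OF assms] by (simp add: abs_le_iff)
qed

lemma eventually_abs_le_one_near:
  assumes "u \<in> O[near S](\<lambda>x. norm (snd x))"
  shows "\<forall>\<^sub>F x in near S. \<bar>u x :: real\<bar> \<le> 1"
proof -
  obtain c where c: "0 < c" "\<forall>\<^sub>F x in near S. norm (u x) \<le> c * norm (norm (snd x))"
    using assms by (rule landau_o.bigE)
  have "\<forall>\<^sub>F x in near S. norm (snd x) < 1 / c"
    unfolding eventually_near using c(1) by (intro exI[of _ "1 / c"]) auto
  with c(2) show ?thesis
  proof eventually_elim
    case (elim x)
    have "c * norm (snd x) < 1" using elim(2) c(1) by (simp add: pos_less_divide_eq mult.commute)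
    thus ?case using elim(1) by simp
  qed
qed

lemma norm_smallo_one_near: "(\<lambda>x. norm (snd x)) \<in> o[near S](\<lambda>_. 1)"
  by (rule landau_o.smallI) (auto simp: eventually_near)

lemma cube_smallo_near: "(\<lambda>x. norm (snd x) ^ 3) \<in> o[near S](\<lambda>x. (norm (snd x))\<^sup>2)"
  using landau_o.small.mult_right[OF norm_smallo_one_near, where h = "\<lambda>x. (norm (snd x))\<^sup>2"]
  by (simp add: power2_eq_square power3_eq_cube mult.assoc)

lemma exp_smallo_near:
  assumes u: "u \<in> O[near S](\<lambda>x. norm (snd x))"
  shows "(\<lambda>x. exp (u x) - (1 + u x + (u x)\<^sup>2 / 2)) \<in> o[near S](\<lambda>x. (norm (snd x))\<^sup>2)"
proof (rule landau_o.big_small_trans)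
  show "(\<lambda>x. exp (u x) - (1 + u x + (u x)\<^sup>2 / 2)) \<in> O[near S](\<lambda>x. \<bar>u x\<bar> ^ 3)"
    by (rule landau_o.bigI[of 1], simp, rule eventually_mono[OF eventually_abs_le_one_near[OF u]])
      (use exp_third_order in auto)
  have "(\<lambda>x. \<bar>u x\<bar> ^ 3) \<in> O[near S](\<lambda>x. norm (snd x) ^ 3)"
    using u by (intro landau_o.big_power) simp
  thus "(\<lambda>x. \<bar>u x\<bar> ^ 3) \<in> o[near S](\<lambda>x. (norm (snd x))\<^sup>2)"
    using cube_smallo_near by (rule landau_o.big_small_trans)
qed

lemma exp_linear_smallo_near:
  assumes u: "u \<in> O[near S](\<lambda>x. (norm (snd x))\<^sup>2)"
  shows "(\<lambda>x. exp (u x) - (1 + u x)) \<in> o[near S](\<lambda>x. (norm (snd x))\<^sup>2)"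
proof -
  have sq: "(\<lambda>x. (norm (snd x))\<^sup>2) \<in> o[near S](\<lambda>x. norm (snd x))"
    using landau_o.small.mult_right[OF norm_smallo_one_near, where h = "\<lambda>x. norm (snd x)"]
    by (simp add: power2_eq_square)
  have u1: "u \<in> o[near S](\<lambda>x. norm (snd x))" using u sq by (rule landau_o.big_small_trans)
  have "(\<lambda>x. exp (u x) - (1 + u x + (u x)\<^sup>2 / 2) + (u x)\<^sup>2 / 2) \<in> o[near S](\<lambda>x. (norm (snd x))\<^sup>2)"
    using landau_o.small_power[OF u1, of 2]
    by (intro sum_in_smallo exp_smallo_near landau_o.small_imp_big[OF u1]) simp_all
  thus ?thesis by (simp add: algebra_simps)
qed

section \<open>Midpoint comparison for nearby points\<close>

text \<open>A positive form is bounded below by a multiple of the squared norm, uniformly over a compact set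
of coefficients: its minimum on \<open>S\<close> times the unit sphere is positive, and the form is homogeneous.\<close>

lemma quadratic_coercive:
  fixes A :: "real^'n \<Rightarrow> real^'n^'n" and b g :: "real^'n \<Rightarrow> real^'n" and a \<kappa> :: "real^'n \<Rightarrow> real" and N :: real
  defines "Q \<equiv> \<lambda>z h s. h \<bullet> (A z *v h) + 2 * s * (g z \<bullet> h) + (b z \<bullet> h + s * a z)\<^sup>2 / N + s\<^sup>2 * \<kappa> z"
  assumes cont: "continuous_on UNIV A" "continuous_on UNIV b" "continuous_on UNIV g"
      "continuous_on UNIV a" "continuous_on UNIV \<kappa>"
    and "compact S" "0 < N"
    and pos: "\<And>z h s. z \<in> S \<Longrightarrow> (h, s) \<noteq> 0 \<Longrightarrow> 0 < Q z h s"
  obtains c where "0 < c" "\<And>z h s. z \<in> S \<Longrightarrow> c * (norm (h, s))\<^sup>2 \<le> Q z h s"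
proof (cases "S = {}")
  case False
  let ?K = "S \<times> sphere (0 :: (real^'n) \<times> real) 1"
  have fst': "continuous_on UNIV (\<lambda>x::(real^'n) \<times> (real^'n) \<times> real. F (fst x))"
    if "continuous_on UNIV F" for F :: "real^'n \<Rightarrow> 'b::topological_space"
    using that by (rule continuous_on_compose2) (auto intro!: continuous_intros)
  have "continuous_on UNIV (\<lambda>x. Q (fst x) (fst (snd x)) (snd (snd x)))"
    unfolding Q_def using \<open>0 < N\<close>
    by (intro continuous_intros continuous_on_matrix_vector_mult fst' cont) auto
  hence "continuous_on ?K (\<lambda>x. Q (fst x) (fst (snd x)) (snd (snd x)))"
    by (rule continuous_on_subset) simp
  moreover have "compact ?K" using \<open>compact S\<close> by (intro compact_Times) auto
  moreover have "?K \<noteq> {}"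
  proof -
    have "(0, 1) \<in> sphere (0 :: (real^'n) \<times> real) 1" by (simp add: norm_Pair)
    thus ?thesis using False by blast
  qed
  ultimately have "\<exists>x\<in>?K. \<forall>y\<in>?K. Q (fst x) (fst (snd x)) (snd (snd x)) \<le> Q (fst y) (fst (snd y)) (snd (snd y))"
    by (intro continuous_attains_inf)
  then obtain x where x: "x \<in> ?K"
    "\<And>y. y \<in> ?K \<Longrightarrow> Q (fst x) (fst (snd x)) (snd (snd x)) \<le> Q (fst y) (fst (snd y)) (snd (snd y))"
    by blast
  define c where "c = Q (fst x) (fst (snd x)) (snd (snd x))"
  have "0 < c"
    unfolding c_def using x(1) by (intro pos) auto
  moreover have "c * (norm (h, s))\<^sup>2 \<le> Q z h s" if "z \<in> S" for z h s
  proof (cases "(h, s) = 0")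
    case False
    define r where "r = norm (h, s)"
    have r: "0 < r" using False by (simp add: r_def)
    have hom: "Q z (t *\<^sub>R h) (t * s) = t\<^sup>2 * Q z h s" for t
    proof -
      have "b z \<bullet> (t *\<^sub>R h) + t * s * a z = t * (b z \<bullet> h + s * a z)" by (simp add: algebra_simps)
      thus ?thesis unfolding Q_def
        by (simp add: matrix_vector_mult_scaleR power_mult_distrib distrib_left) (simp add: power2_eq_square algebra_simps)
    qed
    have "norm ((1 / r) *\<^sub>R (h, s)) = 1" using r by (subst norm_scaleR) (simp add: r_def)
    hence "(z, ((1 / r) *\<^sub>R h, 1 / r * s)) \<in> ?K" using that by simp
    from x(2)[OF this] have "c \<le> (1 / r)\<^sup>2 * Q z h s" by (simp only: c_def fst_conv snd_conv hom)
    hence "c \<le> Q z h s / r\<^sup>2" by (simp add: power_divide)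
    thus ?thesis using r by (simp add: r_def[symmetric] pos_le_divide_eq)
  qed (simp add: Q_def zero_prod_def)
  ultimately show thesis by (rule that)
qed (use that[of 1] in auto)

text \<open>Divided by \<open>exp (V z / N)\<close>, the two sides of the midpoint condition have equal constant terms, and their
difference is the quadratic form in \<open>pos\<close> divided by \<open>2 N\<close>, up to a remainder \<open>o(|h|\<^sup>2 + s\<^sup>2)\<close>. The first-order
parts of the two exponents are opposite and cancel in the sum, but their squares survive and produce
the term \<open>(\<nabla>V \<bullet> h + s f)\<^sup>2 / N\<close>. This is the place where the dimension enters.\<close>

lemma local_comparison:
  fixes V f \<kappa> :: "real^'n \<Rightarrow> real"
  assumes V: "C2 V" and f: "C1 f" and S: "compact S" and \<kappa>: "continuous_on UNIV \<kappa>" and "0 < N"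
    and pos: "\<And>z h s. z \<in> S \<Longrightarrow> (h, s) \<noteq> 0 \<Longrightarrow>
      0 < h \<bullet> (hess V z *v h) + 2 * s * (grad f z \<bullet> h) + (grad V z \<bullet> h + s * f z)\<^sup>2 / N + s\<^sup>2 * \<kappa> z"
  obtains \<delta> where "0 < \<delta>"
    "\<And>z h s. z \<in> S \<Longrightarrow> norm (h, s) < \<delta> \<Longrightarrow> exp (- (s\<^sup>2 * \<kappa> z / (2 * N)))
       \<le> (exp ((V (z - h) - s * f (z - h) - V z) / N) + exp ((V (z + h) + s * f (z + h) - V z) / N)) / 2"
proof -
  define Q where "Q z h s = h \<bullet> (hess V z *v h) + 2 * s * (grad f z \<bullet> h) + (grad V z \<bullet> h + s * f z)\<^sup>2 / N + s\<^sup>2 * \<kappa> z"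
    for z h s
  have contV: "continuous_on UNIV (hess V)" "continuous_on UNIV (grad V)"
    using V by (auto simp: C2_def C1_def)
  have contf: "continuous_on UNIV (grad f)" "continuous_on UNIV f"
    using f C1_continuous by (auto simp: C1_def)
  obtain c where c: "0 < c" "\<And>z h s. z \<in> S \<Longrightarrow> c * (norm (h, s))\<^sup>2 \<le> Q z h s"
    unfolding Q_def by (rule quadratic_coercive[OF contV contf \<kappa> S \<open>0 < N\<close> pos]) blast+
  let ?r = "\<lambda>x. norm (snd x) :: real"
  let ?F = "near S"
  let ?c = "\<lambda>x :: (real^'n) \<times> (real^'n) \<times> real. fst x"
  let ?h = "\<lambda>x :: (real^'n) \<times> (real^'n) \<times> real. fst (snd x)"
  let ?s = "\<lambda>x :: (real^'n) \<times> (real^'n) \<times> real. snd (snd x)"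
  \<comment> \<open>For \<open>\<sigma> = 1\<close> and \<open>\<sigma> = -1\<close>, \<open>w \<sigma>\<close> is the exponent at \<open>z + \<sigma> h\<close>; \<open>N * w \<sigma>\<close> has the odd
    first-order part \<open>\<sigma> * \<beta>\<close> and the even second-order part \<open>q\<close>.\<close>
  define \<beta> where "\<beta> x = grad V (?c x) \<bullet> ?h x + ?s x * f (?c x)" for x
  define q where "q x = ?h x \<bullet> (hess V (?c x) *v ?h x) / 2 + ?s x * (grad f (?c x) \<bullet> ?h x)" for x
  define w where "w \<sigma> x = (V (?c x + \<sigma> *\<^sub>R ?h x) + \<sigma> * (?s x * f (?c x + \<sigma> *\<^sub>R ?h x)) - V (?c x)) / N" for \<sigma> x
  define k where "k x = (?s x)\<^sup>2 * \<kappa> (?c x) / (2 * N)" for x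
  have inner_bigo: "(\<lambda>x. g (?c x) \<bullet> ?h x) \<in> O[?F](?r)" if "continuous_on UNIV g" for g :: "real^'n \<Rightarrow> real^'n"
  proof (rule landau_o.big_trans)
    show "(\<lambda>x. g (?c x) \<bullet> ?h x) \<in> O[?F](\<lambda>x. norm (g (?c x)) * norm (?h x))"
      by (rule landau_o.bigI[of 1]) (auto intro!: always_eventually Cauchy_Schwarz_ineq2)
    show "(\<lambda>x. norm (g (?c x)) * norm (?h x)) \<in> O[?F](?r)"
      using landau_o.big.mult[OF bigo_one_center[OF S that] shift_bigo[of S]] by simp
  qed
  have scalar_bigo: "(\<lambda>x. g (?c x)) \<in> O[?F](\<lambda>_. 1)" if "continuous_on UNIV g" for g :: "real^'n \<Rightarrow> real"
    using bigo_one_center[OF S that] by simp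
  have hess_bigo: "(\<lambda>x. ?h x \<bullet> (hess V (?c x) *v ?h x)) \<in> O[?F](\<lambda>x. (?r x)\<^sup>2)"
  proof (rule landau_o.big_trans)
    show "(\<lambda>x. ?h x \<bullet> (hess V (?c x) *v ?h x)) \<in> O[?F](\<lambda>x. norm (hess V (?c x)) * (norm (?h x) * norm (?h x)))"
    proof (rule landau_o.bigI[of 1])
      have "\<bar>h \<bullet> (A *v h)\<bar> \<le> norm A * (norm h * norm h)" for A :: "real^'n^'n" and h
        using Cauchy_Schwarz_ineq2[of h "A *v h"] mult_left_mono[OF norm_matrix_vector_le[of A h], of "norm h"]
        by (simp add: mult_ac)
      thus "\<forall>\<^sub>F x in ?F. norm (?h x \<bullet> (hess V (?c x) *v ?h x)) \<le> 1 * norm (norm (hess V (?c x)) * (norm (?h x) * norm (?h x)))"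
        by (auto intro!: always_eventually)
    qed simp
    show "(\<lambda>x. norm (hess V (?c x)) * (norm (?h x) * norm (?h x))) \<in> O[?F](\<lambda>x. (?r x)\<^sup>2)"
      using landau_o.big.mult[OF bigo_one_center[OF S contV(1)] landau_o.big.mult[OF shift_bigo[of S] shift_bigo[of S]]]
      by (simp add: power2_eq_square)
  qed
  have \<beta>_bigo: "\<beta> \<in> O[?F](?r)"
    unfolding \<beta>_def using landau_o.big.mult[OF param_bigo[of S] scalar_bigo[OF contf(2)]]
    by (intro sum_in_bigo inner_bigo contV) simp
  have q_bigo: "q \<in> O[?F](\<lambda>x. (?r x)\<^sup>2)"
    unfolding q_def using hess_bigo landau_o.big.mult[OF param_bigo[of S] inner_bigo[OF contf(1)]]
    by (intro sum_in_bigo) (simp_all add: power2_eq_square)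
  have k_bigo: "k \<in> O[?F](\<lambda>x. (?r x)\<^sup>2)"
    unfolding k_def using \<open>0 < N\<close> landau_o.big.mult[OF landau_o.big_power[OF param_bigo[of S], of 2] scalar_bigo[OF \<kappa>]]
    by simp
  have sq_bigo: "u \<in> O[?F](?r)" if u: "u \<in> O[?F](\<lambda>x. (?r x)\<^sup>2)" for u :: "_ \<Rightarrow> real"
  proof (rule landau_o.big_trans[OF u])
    show "(\<lambda>x. (?r x)\<^sup>2) \<in> O[?F](?r)"
      using landau_o.big.mult_right[OF landau_o.small_imp_big[OF norm_smallo_one_near], where h = ?r]
      by (simp add: power2_eq_square)
  qed
  have w_smallo: "(\<lambda>x. w \<sigma> x - (\<sigma> * \<beta> x + q x) / N) \<in> o[?F](\<lambda>x. (?r x)\<^sup>2)"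
    and w_bigo: "w \<sigma> \<in> O[?F](?r)"
    and w_sq: "(\<lambda>x. (w \<sigma> x)\<^sup>2 - (\<beta> x)\<^sup>2 / N\<^sup>2) \<in> o[?F](\<lambda>x. (?r x)\<^sup>2)" if "\<bar>\<sigma>\<bar> = 1" for \<sigma>
  proof -
    have \<sigma>: "\<sigma> * \<sigma> = 1" using that by (metis abs_mult_self_eq mult_1)
    have \<sigma>': "\<sigma> * (\<sigma> * u) = u" for u by (simp add: mult.assoc[symmetric] \<sigma>)
    define T1 where "T1 x = f (?c x + \<sigma> *\<^sub>R ?h x) - f (?c x) - \<sigma> * (grad f (?c x) \<bullet> ?h x)" for x
    define T2 where "T2 x = V (?c x + \<sigma> *\<^sub>R ?h x) - V (?c x) - \<sigma> * (grad V (?c x) \<bullet> ?h x)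
      - (?h x \<bullet> (hess V (?c x) *v ?h x)) / 2" for x
    have T1: "T1 \<in> o[?F](?r)" unfolding T1_def by (rule first_order_smallo[OF f S that])
    have T2: "T2 \<in> o[?F](\<lambda>x. (?r x)\<^sup>2)" unfolding T2_def by (rule second_order_smallo[OF V S that])
    have eq: "w \<sigma> x - (\<sigma> * \<beta> x + q x) / N = (T2 x + \<sigma> * (?s x * T1 x)) / N" for x
      unfolding w_def \<beta>_def q_def T1_def T2_def
      by (simp add: algebra_simps \<sigma>' diff_divide_distrib add_divide_distrib)
    have "(\<lambda>x. ?s x * T1 x) \<in> o[?F](\<lambda>x. (?r x)\<^sup>2)"
      using landau_o.big_small_mult[OF param_bigo[of S] T1] by (simp add: power2_eq_square)
    moreover have "\<sigma> \<noteq> 0" using that by auto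
    ultimately have "(\<lambda>x. T2 x + \<sigma> * (?s x * T1 x)) \<in> o[?F](\<lambda>x. (?r x)\<^sup>2)"
      by (intro sum_in_smallo T2) simp
    thus 1: "(\<lambda>x. w \<sigma> x - (\<sigma> * \<beta> x + q x) / N) \<in> o[?F](\<lambda>x. (?r x)\<^sup>2)"
      unfolding eq using \<open>0 < N\<close> by simp
    have "(\<lambda>x. (w \<sigma> x - (\<sigma> * \<beta> x + q x) / N) + q x / N) \<in> O[?F](\<lambda>x. (?r x)\<^sup>2)"
      using landau_o.small_imp_big[OF 1] q_bigo \<open>0 < N\<close> by (intro sum_in_bigo(1)[of "\<lambda>x. w \<sigma> x - (\<sigma> * \<beta> x + q x) / N"]) simp_all
    hence 2: "(\<lambda>x. w \<sigma> x - \<sigma> * \<beta> x / N) \<in> O[?F](\<lambda>x. (?r x)\<^sup>2)"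
      by (simp add: add_divide_distrib)
    have \<beta>N: "(\<lambda>x. \<sigma> * \<beta> x / N) \<in> O[?F](?r)" using \<beta>_bigo \<open>0 < N\<close> \<open>\<sigma> \<noteq> 0\<close> by simp
    have "(\<lambda>x. (w \<sigma> x - \<sigma> * \<beta> x / N) + \<sigma> * \<beta> x / N) \<in> O[?F](?r)"
      by (intro sum_in_bigo sq_bigo 2 \<beta>N)
    thus 3: "w \<sigma> \<in> O[?F](?r)" by simp
    have "(\<lambda>x. (w \<sigma> x - \<sigma> * \<beta> x / N) * (w \<sigma> x + \<sigma> * \<beta> x / N)) \<in> O[?F](\<lambda>x. (?r x)\<^sup>2 * ?r x)"
      by (intro landau_o.big.mult 2 sum_in_bigo 3 \<beta>N)
    also have "(\<lambda>x. (?r x)\<^sup>2 * ?r x) = (\<lambda>x :: (real^'n) \<times> (real^'n) \<times> real. ?r x ^ 3)"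
      by (simp add: power2_eq_square power3_eq_cube)
    also have "(\<lambda>x. ?r x ^ 3) \<in> o[?F](\<lambda>x. (?r x)\<^sup>2)" by (rule cube_smallo_near)
    finally have "(\<lambda>x. (w \<sigma> x - \<sigma> * \<beta> x / N) * (w \<sigma> x + \<sigma> * \<beta> x / N)) \<in> o[?F](\<lambda>x. (?r x)\<^sup>2)" .
    moreover have "(w \<sigma> x - \<sigma> * \<beta> x / N) * (w \<sigma> x + \<sigma> * \<beta> x / N) = (w \<sigma> x)\<^sup>2 - (\<beta> x)\<^sup>2 / N\<^sup>2" for x
    proof -
      have "(\<sigma> * \<beta> x / N) * (\<sigma> * \<beta> x / N) = (\<beta> x)\<^sup>2 / N\<^sup>2"
        using \<sigma>' by (simp add: power2_eq_square mult_ac)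
      thus ?thesis by (simp add: power2_eq_square algebra_simps)
    qed
    ultimately show "(\<lambda>x. (w \<sigma> x)\<^sup>2 - (\<beta> x)\<^sup>2 / N\<^sup>2) \<in> o[?F](\<lambda>x. (?r x)\<^sup>2)" by simp
  qed
  \<comment> \<open>The remainders of the exponentials (\<open>E\<close> and \<open>L\<close>), of the exponents (\<open>W\<close>) and of their
    squares (\<open>Z\<close>) together make up the remainder \<open>D\<close> of the whole expansion.\<close>
  define E where "E u x = exp (u x) - (1 + u x + (u x)\<^sup>2 / 2)" for u :: "(real^'n) \<times> (real^'n) \<times> real \<Rightarrow> real" and x
  define L where "L x = exp (- k x) - (1 + - k x)" for x
  define W where "W \<sigma> x = w \<sigma> x - (\<sigma> * \<beta> x + q x) / N" for \<sigma> x
  define Z where "Z \<sigma> x = (w \<sigma> x)\<^sup>2 - (\<beta> x)\<^sup>2 / N\<^sup>2" for \<sigma> x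
  define D where "D x = (E (w (-1)) x + E (w 1) x) / 2 + (W (-1) x + W 1 x) / 2 + (Z (-1) x + Z 1 x) / 4 - L x" for x
  have "L \<in> o[?F](\<lambda>x. (?r x)\<^sup>2)"
    unfolding L_def using k_bigo by (intro exp_linear_smallo_near) simp
  moreover have "E (w \<sigma>) \<in> o[?F](\<lambda>x. (?r x)\<^sup>2)" "W \<sigma> \<in> o[?F](\<lambda>x. (?r x)\<^sup>2)" "Z \<sigma> \<in> o[?F](\<lambda>x. (?r x)\<^sup>2)"
    if "\<bar>\<sigma>\<bar> = 1" for \<sigma>
    unfolding E_def W_def Z_def using that by (intro exp_smallo_near w_bigo w_smallo w_sq; simp)+
  ultimately have "D \<in> o[?F](\<lambda>x. (?r x)\<^sup>2)"
  proof -
    assume L: "L \<in> o[?F](\<lambda>x. (?r x)\<^sup>2)"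
      and E: "\<And>\<sigma>. \<bar>\<sigma>\<bar> = 1 \<Longrightarrow> E (w \<sigma>) \<in> o[?F](\<lambda>x. (?r x)\<^sup>2)"
      and W: "\<And>\<sigma>. \<bar>\<sigma>\<bar> = 1 \<Longrightarrow> W \<sigma> \<in> o[?F](\<lambda>x. (?r x)\<^sup>2)"
      and Z: "\<And>\<sigma>. \<bar>\<sigma>\<bar> = 1 \<Longrightarrow> Z \<sigma> \<in> o[?F](\<lambda>x. (?r x)\<^sup>2)"
    have half: "(\<lambda>x. (u (-1) x + u 1 x) / a) \<in> o[?F](\<lambda>x. (?r x)\<^sup>2)"
      if "\<And>\<sigma>. \<bar>\<sigma>\<bar> = 1 \<Longrightarrow> u \<sigma> \<in> o[?F](\<lambda>x. (?r x)\<^sup>2)" "a \<noteq> 0"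
      for u :: "real \<Rightarrow> (real^'n) \<times> (real^'n) \<times> real \<Rightarrow> real" and a :: real
    proof -
      have "(\<lambda>x. u (-1) x + u 1 x) \<in> o[?F](\<lambda>x. (?r x)\<^sup>2)"
        by (rule sum_in_smallo(1)) (rule that(1), simp)+
      thus ?thesis using \<open>a \<noteq> 0\<close> by simp
    qed
    show ?thesis
      unfolding D_def
      by (rule sum_in_smallo(2)[OF sum_in_smallo(1)[OF sum_in_smallo(1)[OF half half] half] L])
        (use E W Z in auto)
  qed
  moreover have "0 < c / (2 * N)" using c \<open>0 < N\<close> by simp
  ultimately have "\<forall>\<^sub>F x in ?F. norm (D x) \<le> c / (2 * N) * norm ((?r x)\<^sup>2)"
    by (rule landau_o.smallD)
  then obtain \<delta> where \<delta>: "0 < \<delta>" "\<And>z p. z \<in> S \<Longrightarrow> norm p < \<delta> \<Longrightarrow> \<bar>D (z, p)\<bar> \<le> c / (2 * N) * (norm p)\<^sup>2"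
    unfolding eventually_near by auto
  have D_eq: "(exp (w (-1) x) + exp (w 1 x)) / 2 - exp (- k x) = D x + Q (?c x) (?h x) (?s x) / (2 * N)" for x
  proof -
    have "Q (?c x) (?h x) (?s x) / (2 * N) = q x / N + (\<beta> x)\<^sup>2 / N\<^sup>2 / 2 + k x"
      using \<open>0 < N\<close> by (simp add: Q_def q_def \<beta>_def k_def add_divide_distrib power2_eq_square mult_ac)
    moreover have "D x = (exp (w (-1) x) + exp (w 1 x)) / 2 - exp (- k x) - q x / N - (\<beta> x)\<^sup>2 / N\<^sup>2 / 2 - k x"
      unfolding D_def E_def W_def Z_def L_def by (simp add: add_divide_distrib diff_divide_distrib)
    ultimately show ?thesis by simp
  qed
  show thesis
  proof (rule that[OF \<delta>(1)])
    fix z h :: "real^'n" and s :: real assume z: "z \<in> S" and p: "norm (h, s) < \<delta>"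
    have "c / (2 * N) * (norm (h, s))\<^sup>2 \<le> Q z h s / (2 * N)"
      using divide_right_mono[OF c(2)[OF z, of h s], of "2 * N"] \<open>0 < N\<close> by simp
    hence nonneg: "0 \<le> D (z, h, s) + Q z h s / (2 * N)" using \<delta>(2)[OF z p] by linarith
    have "(exp ((V (z - h) - s * f (z - h) - V z) / N) + exp ((V (z + h) + s * f (z + h) - V z) / N)) / 2
        - exp (- (s\<^sup>2 * \<kappa> z / (2 * N))) = D (z, h, s) + Q z h s / (2 * N)"
      using D_eq[of "(z, h, s)"] by (simp add: w_def k_def)
    with nonneg show "exp (- (s\<^sup>2 * \<kappa> z / (2 * N)))
       \<le> (exp ((V (z - h) - s * f (z - h) - V z) / N) + exp ((V (z + h) + s * f (z + h) - V z) / N)) / 2"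
      by linarith
  qed
qed

section \<open>Midpoint comparison for distant points\<close>

lemma strict_tangent_inequality:
  fixes V :: "real^'n \<Rightarrow> real"
  assumes "C2 V" "\<And>x. pos_def (hess V x)" "h \<noteq> 0"
  shows "V x + grad V x \<bullet> h < V (x + h)"
proof -
  obtain t where t: "V (x + h) = V x + grad V x \<bullet> h + (hess V (x + t *\<^sub>R h) *v h) \<bullet> h / 2"
    using taylor_hess[OF assms(1)] by metis
  have "0 < h \<bullet> (hess V (x + t *\<^sub>R h) *v h)" using assms(2,3) by (simp add: pos_def_def)
  thus ?thesis using t by (simp add: inner_commute)
qed

lemma hess_pos_def_imp_convex:
  fixes V :: "real^'n \<Rightarrow> real"
  assumes "C2 V" "\<And>x. pos_def (hess V x)"
  shows "convex_on UNIV V"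
proof (rule convex_onI)
  fix t :: real and x y :: "real^'n" assume t: "0 < t" "t < 1"
  let ?m = "(1 - t) *\<^sub>R x + t *\<^sub>R y"
  have tangent: "V ?m + grad V ?m \<bullet> (z - ?m) \<le> V z" for z
    using strict_tangent_inequality[OF assms, of "z - ?m" ?m] by (cases "z = ?m") auto
  have "(1 - t) * (V ?m + grad V ?m \<bullet> (x - ?m)) + t * (V ?m + grad V ?m \<bullet> (y - ?m)) \<le> (1 - t) * V x + t * V y"
    using t tangent by (intro add_mono mult_left_mono) auto
  moreover have "(1 - t) * (grad V ?m \<bullet> (x - ?m)) + t * (grad V ?m \<bullet> (y - ?m)) = 0"
  proof -
    have "(1 - t) * (grad V ?m \<bullet> (x - ?m)) + t * (grad V ?m \<bullet> (y - ?m))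
        = grad V ?m \<bullet> ((1 - t) *\<^sub>R (x - ?m) + t *\<^sub>R (y - ?m))"
      by (simp add: inner_add_right)
    also have "(1 - t) *\<^sub>R (x - ?m) + t *\<^sub>R (y - ?m) = 0" by (simp add: algebra_simps)
    finally show ?thesis by simp
  qed
  ultimately show "V ?m \<le> (1 - t) * V x + t * V y"
    by (simp add: algebra_simps)
qed simp

text \<open>Twice the defect in midpoint convexity. For a convex function it grows with the segment, so a lower bound for
segments of one length near a compact set holds for all longer ones, wherever they end.\<close>

definition midpoint_gap :: "('a::real_vector \<Rightarrow> real) \<Rightarrow> 'a \<Rightarrow> 'a \<Rightarrow> real" where
  "midpoint_gap V x y = V x + V y - 2 * V ((1/2) *\<^sub>R (x + y))"

lemma midpoint_gap_commute: "midpoint_gap V x y = midpoint_gap V y x"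
  by (simp add: midpoint_gap_def add.commute)

lemma midpoint_gap_nonneg:
  assumes "convex_on UNIV V" shows "0 \<le> midpoint_gap V x y"
  using convex_onD[OF assms, of "1/2" x y] by (simp add: midpoint_gap_def scaleR_add_right)

text \<open>With \<open>m\<close> the midpoint of the shorter segment, both \<open>x + d/2\<close> and \<open>x + t d\<close> lie between \<open>m\<close> and
\<open>x + d\<close>, and the weights that \<open>x + d\<close> receives from two copies of the first and one of the second add
up to one. Convexity therefore gives
\<open>V (x + t d) + 2 V (x + d/2) \<le> 2 V m + V (x + d)\<close>, a rearrangement of the claim.\<close>

lemma midpoint_gap_mono:
  fixes V :: "'a::real_vector \<Rightarrow> real"
  assumes cvx: "convex_on UNIV V" and t: "0 \<le> t" "t \<le> 1"
  shows "midpoint_gap V x (x + t *\<^sub>R d) \<le> midpoint_gap V x (x + d)"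
proof -
  define m where "m = x + (t / 2) *\<^sub>R d"
  define l where "l = (1 - t) / (2 - t)"
  have l: "0 \<le> l" "l \<le> 1" "0 \<le> 1 - 2 * l" "l * (2 - t) = 1 - t"
    using t by (auto simp: l_def field_simps)
  have "(1 - l) *\<^sub>R m + l *\<^sub>R (x + d) = x + ((t + l * (2 - t)) / 2) *\<^sub>R d"
    by (simp add: m_def algebra_simps add_divide_distrib diff_divide_distrib)
  hence "(1 - l) *\<^sub>R m + l *\<^sub>R (x + d) = x + (1/2) *\<^sub>R d" by (simp add: l)
  with convex_onD[OF cvx l(1,2), of m "x + d"]
  have 1: "V (x + (1/2) *\<^sub>R d) \<le> (1 - l) * V m + l * V (x + d)" by simp
  have "(1 - (1 - 2 * l)) *\<^sub>R m + (1 - 2 * l) *\<^sub>R (x + d) = x + (1 - l * (2 - t)) *\<^sub>R d"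
    by (simp add: m_def algebra_simps)
  hence "(1 - (1 - 2 * l)) *\<^sub>R m + (1 - 2 * l) *\<^sub>R (x + d) = x + t *\<^sub>R d" by (simp add: l)
  with convex_onD[OF cvx l(3), of m "x + d"] l(1)
  have 2: "V (x + t *\<^sub>R d) \<le> 2 * l * V m + (1 - 2 * l) * V (x + d)" by simp
  have mid: "(1/2) *\<^sub>R (x + (x + e)) = x + (1/2) *\<^sub>R e" for e
    by (simp add: scaleR_add_right scaleR_left_distrib[symmetric] add.assoc[symmetric])
  have "V (x + t *\<^sub>R d) + 2 * V (x + (1/2) *\<^sub>R d) \<le> 2 * V m + V (x + d)"
    using 1 2 by (simp add: algebra_simps)
  thus ?thesis unfolding midpoint_gap_def mid by (simp add: m_def)
qed

lemma midpoint_gap_uniform: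
  fixes V :: "real^'n \<Rightarrow> real"
  assumes V: "C2 V" "\<And>x. pos_def (hess V x)" and "compact K" "0 < \<delta>"
  obtains c where "0 < c" "\<And>x y. x \<in> K \<Longrightarrow> \<delta> \<le> norm (y - x) \<Longrightarrow> c \<le> midpoint_gap V x y"
proof (cases "K = {}")
  case False
  have pos: "0 < midpoint_gap V x (x + d)" if "d \<noteq> 0" for x d
  proof -
    let ?m = "x + (1/2) *\<^sub>R d"
    have mid: "(1/2) *\<^sub>R (x + (x + d)) = ?m"
      by (simp add: scaleR_add_right scaleR_left_distrib[symmetric] add.assoc[symmetric])
    have "V ?m + grad V ?m \<bullet> ((1/2) *\<^sub>R d) < V (?m + (1/2) *\<^sub>R d)"
      "V ?m + grad V ?m \<bullet> (- (1/2) *\<^sub>R d) < V (?m + - (1/2) *\<^sub>R d)"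
      using that by (intro strict_tangent_inequality V; simp)+
    moreover have "?m + (1/2) *\<^sub>R d = x + d" "?m + - (1/2) *\<^sub>R d = x"
      by (simp_all add: add.assoc scaleR_left_distrib[symmetric])
    ultimately show ?thesis unfolding midpoint_gap_def mid by simp
  qed
  let ?K = "K \<times> sphere (0 :: real^'n) 1"
  let ?g = "\<lambda>p. midpoint_gap V (fst p) (fst p + \<delta> *\<^sub>R snd p)"
  have contV: "continuous_on UNIV V" using V(1) by (intro C1_continuous C2_imp_C1)
  have comp: "continuous_on UNIV (\<lambda>p. V (u p))" if "continuous_on UNIV u" for u :: "(real^'n) \<times> (real^'n) \<Rightarrow> real^'n"
    using contV that by (rule continuous_on_compose2) auto
  have "continuous_on UNIV ?g"
    unfolding midpoint_gap_def by (intro continuous_intros comp)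
  hence "continuous_on ?K ?g" by (rule continuous_on_subset) simp
  moreover have "compact ?K" using \<open>compact K\<close> by (intro compact_Times) auto
  moreover have "?K \<noteq> {}"
  proof -
    have "axis undefined 1 \<in> sphere (0 :: real^'n) 1" by simp
    thus ?thesis using False by blast
  qed
  ultimately have "\<exists>p\<in>?K. \<forall>q\<in>?K. ?g p \<le> ?g q"
    by (intro continuous_attains_inf)
  then obtain p where p: "p \<in> ?K" "\<And>q. q \<in> ?K \<Longrightarrow> ?g p \<le> ?g q" by blast
  show thesis
  proof (rule that[of "?g p"])
    show "0 < ?g p" using p(1) \<open>0 < \<delta>\<close> by (intro pos) auto
    fix x y assume xy: "x \<in> K" "\<delta> \<le> norm (y - x)"
    define r where "r = norm (y - x)"
    have r: "0 < r" "\<delta> \<le> r" using xy \<open>0 < \<delta>\<close> by (auto simp: r_def)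
    have "?g p \<le> ?g (x, (1 / r) *\<^sub>R (y - x))"
      using xy(1) r by (intro p(2)) (auto simp: r_def)
    also have "\<dots> = midpoint_gap V x (x + (\<delta> / r) *\<^sub>R (y - x))" by simp
    also have "\<dots> \<le> midpoint_gap V x (x + (y - x))"
      using r \<open>0 < \<delta>\<close> by (intro midpoint_gap_mono hess_pos_def_imp_convex V) auto
    finally show "?g p \<le> midpoint_gap V x y" by simp
  qed
qed (use that[of 1] in auto)

text \<open>If only the midpoint of the segment lies in \<open>K\<close>, half of the segment starts in \<open>K\<close>, and the gap
of the half is bounded by the gap of the whole.\<close>

lemma midpoint_gap_uniform_segment:
  fixes V :: "real^'n \<Rightarrow> real"
  assumes V: "C2 V" "\<And>x. pos_def (hess V x)" and "compact K" "0 < \<delta>"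
  obtains c where "0 < c" "\<And>z h. {z - h, z, z + h} \<inter> K \<noteq> {} \<Longrightarrow> \<delta> \<le> norm h \<Longrightarrow> c \<le> midpoint_gap V (z - h) (z + h)"
proof -
  obtain c where c: "0 < c" "\<And>x y. x \<in> K \<Longrightarrow> \<delta> \<le> norm (y - x) \<Longrightarrow> c \<le> midpoint_gap V x y"
    using midpoint_gap_uniform[OF assms] by blast
  have dbl: "norm h \<le> norm (h + h)" for h :: "real^'n"
    by (simp add: scaleR_2[symmetric])
  show thesis
  proof (rule that[OF c(1)])
    fix z h :: "real^'n" assume "{z - h, z, z + h} \<inter> K \<noteq> {}" and h: "\<delta> \<le> norm h"
    then consider "z - h \<in> K" | "z \<in> K" | "z + h \<in> K" by auto
    thus "c \<le> midpoint_gap V (z - h) (z + h)"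
    proof cases
      case 1
      have "\<delta> \<le> norm (z + h - (z - h))" using h dbl[of h] by (simp add: algebra_simps)
      thus ?thesis using c(2)[OF 1] by blast
    next
      case 2
      have "c \<le> midpoint_gap V z (z + h)" using h by (intro c(2)[OF 2]) simp
      also have "\<dots> = midpoint_gap V (z + h) (z + h + (1/2) *\<^sub>R (- 2 *\<^sub>R h))"
        by (subst midpoint_gap_commute) simp
      also have "\<dots> \<le> midpoint_gap V (z + h) (z + h + (- 2 *\<^sub>R h))"
        by (intro midpoint_gap_mono hess_pos_def_imp_convex V) auto
      also have "\<dots> = midpoint_gap V (z - h) (z + h)"
        by (subst midpoint_gap_commute) (simp add: scaleR_2)
      finally show ?thesis .
    next
      case 3
      have "\<delta> \<le> norm (z - h - (z + h))" using h dbl[of "- h"] by (simp add: algebra_simps)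
      thus ?thesis using c(2)[OF 3] by (subst midpoint_gap_commute) blast
    qed
  qed
qed

lemma exp_midpoint: "exp ((a + b) / 2) \<le> (exp a + exp b) / (2::real)"
  using convex_onD[OF exp_convex, of "1/2" a b] by (simp add: add_divide_distrib)

text \<open>The hypothesis of Borell--Brascamp--Lieb for all pairs \<open>x = z - h\<close>, \<open>y = z + h\<close>. Short segments centred in
the ball of radius \<open>R + 1\<close> are covered by the local expansion. Short segments centred outside do not
meet the support of \<open>f\<close>, since \<open>h\<close> has norm less than \<open>1\<close>. Long segments with an endpoint or their midpoint in the ball have a gap of at
least \<open>c\<close>, which dominates the perturbation for small \<open>s\<close>. On all others the perturbation vanishes. Outside the
local regime the arithmetic mean of the exponents suffices, by convexity of \<open>exp\<close>.\<close>

lemma global_comparison: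
  fixes V f \<kappa> :: "real^'n \<Rightarrow> real"
  assumes V: "C2 V" "\<And>x. pos_def (hess V x)" and f: "C1 f" and \<kappa>: "continuous_on UNIV \<kappa>"
    and supp: "\<And>x. R < norm x \<Longrightarrow> f x = 0" and "0 < N"
    and pos: "\<And>z h s. norm z \<le> R + 1 \<Longrightarrow> (h, s) \<noteq> 0 \<Longrightarrow>
      0 < h \<bullet> (hess V z *v h) + 2 * s * (grad f z \<bullet> h) + (grad V z \<bullet> h + s * f z)\<^sup>2 / N + s\<^sup>2 * \<kappa> z"
    and bf: "\<And>x. \<bar>f x\<bar> \<le> M" and b\<kappa>: "\<And>x. norm x \<le> R + 1 \<Longrightarrow> \<bar>\<kappa> x\<bar> \<le> M'"
  obtains s0 where "0 < s0"
    "\<And>s x y. \<bar>s\<bar> < s0 \<Longrightarrow> exp ((V ((1/2) *\<^sub>R (x + y))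
          - s\<^sup>2 / 2 * (indicator (cball 0 (R + 1)) ((1/2) *\<^sub>R (x + y)) * \<kappa> ((1/2) *\<^sub>R (x + y)))) / N)
       \<le> (exp ((V x - s * f x) / N) + exp ((V y + s * f y) / N)) / 2"
proof -
  let ?S = "cball (0 :: real^'n) (R + 1)"
  obtain \<delta> where \<delta>: "0 < \<delta>"
    "\<And>z h s. z \<in> ?S \<Longrightarrow> norm (h, s) < \<delta> \<Longrightarrow> exp (- (s\<^sup>2 * \<kappa> z / (2 * N)))
       \<le> (exp ((V (z - h) - s * f (z - h) - V z) / N) + exp ((V (z + h) + s * f (z + h) - V z) / N)) / 2"
    by (rule local_comparison[OF V(1) f compact_cball \<kappa> \<open>0 < N\<close>, of 0 "R + 1"]) (use pos in auto)
  define \<delta>' where "\<delta>' = min (\<delta> / 2) 1"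
  have \<delta>': "0 < \<delta>'" "\<delta>' \<le> \<delta> / 2" "\<delta>' \<le> 1" using \<delta> by (auto simp: \<delta>'_def)
  obtain c where c: "0 < c"
    "\<And>z h. {z - h, z, z + h} \<inter> ?S \<noteq> {} \<Longrightarrow> \<delta>' \<le> norm h \<Longrightarrow> c \<le> midpoint_gap V (z - h) (z + h)"
    using midpoint_gap_uniform_segment[OF V compact_cball \<delta>'(1)] by metis
  have M: "0 \<le> M" using bf[of 0] by linarith
  \<comment> \<open>For \<open>s\<close> below \<open>s0 \<le> 1\<close> the perturbation \<open>s * (f y - f x) + s\<^sup>2 * k\<close> is at most \<open>s0 * B\<close>, hence at most the gap \<open>c\<close>.\<close>
  define B where "B = 2 * M + \<bar>M'\<bar> + 1"
  have B: "0 < B" using M by (simp add: B_def)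
  define s0 where "s0 = min (min \<delta>' 1) (c / B)"
  have s0: "0 < s0" "s0 \<le> \<delta>'" "s0 \<le> 1" "s0 * B \<le> c"
  proof -
    have "s0 \<le> c / B" by (simp add: s0_def)
    thus "s0 * B \<le> c" using B by (simp add: pos_le_divide_eq)
  qed (use \<delta>' c(1) B in \<open>auto simp: s0_def\<close>)
  show thesis
  proof (rule that[OF s0(1)])
    fix s :: real and x y :: "real^'n" assume s: "\<bar>s\<bar> < s0"
    define z where "z = (1/2) *\<^sub>R (x + y)"
    define h where "h = (1/2) *\<^sub>R (y - x)"
    define k where "k = indicator ?S z * \<kappa> z"
    have "(1/2) *\<^sub>R x + (1/2) *\<^sub>R x = x" "(1/2) *\<^sub>R y + (1/2) *\<^sub>R y = y"
      by (simp_all add: scaleR_left_distrib[symmetric])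
    hence xy: "x = z - h" "y = z + h"
      by (simp_all add: z_def h_def algebra_simps)
    have gap: "midpoint_gap V x y = V x + V y - 2 * V z" by (simp add: midpoint_gap_def z_def)
    let ?claim = "exp ((V ((1/2) *\<^sub>R (x + y))
          - s\<^sup>2 / 2 * (indicator ?S ((1/2) *\<^sub>R (x + y)) * \<kappa> ((1/2) *\<^sub>R (x + y)))) / N)
       \<le> (exp ((V x - s * f x) / N) + exp ((V y + s * f y) / N)) / 2"
    have convex_case: ?claim if "0 \<le> midpoint_gap V x y + s * (f y - f x) + s\<^sup>2 * k"
    proof -
      have "(V z - s\<^sup>2 / 2 * k) / N \<le> ((V x - s * f x) / N + (V y + s * f y) / N) / 2"
        using that \<open>0 < N\<close> unfolding gap
        by (simp add: add_divide_distrib[symmetric] divide_right_mono divide_simps) (simp add: algebra_simps)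
      hence "exp ((V z - s\<^sup>2 / 2 * k) / N) \<le> exp (((V x - s * f x) / N + (V y + s * f y) / N) / 2)" by simp
      also have "\<dots> \<le> (exp ((V x - s * f x) / N) + exp ((V y + s * f y) / N)) / 2" by (rule exp_midpoint)
      finally show ?thesis by (simp add: k_def z_def)
    qed
    show ?claim
    proof (cases "norm h < \<delta>'")
      case small: True
      show ?thesis
      proof (cases "z \<in> ?S")
        case True
        have "norm (h, s) \<le> norm h + \<bar>s\<bar>" using norm_Pair_le[of h s] by simp
        also have "\<dots> < \<delta>" using small s s0 \<delta>' by linarith
        finally have "exp (- (s\<^sup>2 * \<kappa> z / (2 * N)))
          \<le> (exp ((V x - s * f x - V z) / N) + exp ((V y + s * f y - V z) / N)) / 2"
          using \<delta>(2)[OF True] by (simp add: xy)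
        from mult_left_mono[OF this, of "exp (V z / N)"]
        show ?thesis
          using True \<open>0 < N\<close> unfolding z_def[symmetric]
          by (simp add: exp_add[symmetric] distrib_left diff_divide_distrib add_divide_distrib mult.assoc)
      next
        case False
        have "R < norm (z - h)" "R < norm (z + h)"
          using False small \<delta>' norm_triangle_ineq2[of z h] norm_triangle_ineq2[of z "- h"] by auto
        hence "f x = 0" "f y = 0" using supp by (auto simp: xy)
        thus ?thesis using False midpoint_gap_nonneg[OF hess_pos_def_imp_convex[OF V]]
          by (intro convex_case) (simp add: k_def)
      qed
    next
      case large: False
      show ?thesis
      proof (cases "{x, z, y} \<inter> ?S = {}")
        case True
        hence "f x = 0" "f y = 0" "k = 0" using supp by (auto simp: k_def)
        thus ?thesis using midpoint_gap_nonneg[OF hess_pos_def_imp_convex[OF V]]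
          by (intro convex_case) simp
      next
        case False
        have "c \<le> midpoint_gap V x y"
          using c(2)[of z h] False large by (simp add: xy)
        moreover have "\<bar>s * (f y - f x)\<bar> \<le> s0 * (2 * M)"
          using bf[of x] bf[of y] s s0 unfolding abs_mult by (intro mult_mono) auto
        moreover have "\<bar>s\<^sup>2 * k\<bar> \<le> s0 * \<bar>M'\<bar>"
        proof -
          have "s\<^sup>2 = \<bar>s\<bar> * \<bar>s\<bar>" by (simp add: power2_eq_square)
          also have "\<dots> \<le> s0 * 1" using s s0 by (intro mult_mono) auto
          finally have "s\<^sup>2 \<le> s0" by simp
          moreover have "\<bar>k\<bar> \<le> \<bar>M'\<bar>"
            using b\<kappa>[of z] by (auto simp: k_def indicator_def)
          ultimately show ?thesis unfolding abs_mult using s0 by (intro mult_mono) auto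
        qed
        moreover have "s0 * (2 * M) + s0 * \<bar>M'\<bar> \<le> c"
          using s0 by (simp add: B_def algebra_simps)
        ultimately show ?thesis by (intro convex_case) linarith
      qed
    qed
  qed
qed

section \<open>The second-order term of the integral inequality\<close>

text \<open>Taking \<open>-1/k\<close>-th powers turns the density \<open>exp (- a)\<close> into \<open>exp (a / k)\<close>, so the power mean condition becomes
a midpoint convexity condition.\<close>

lemma power_mean_le_exp:
  assumes "0 < k" "exp (c / real k) \<le> (exp (a / real k) + exp (b / real k)) / 2"
  shows "power_mean_le k (ennreal (exp (- a))) (ennreal (exp (- b))) (ennreal (exp (- c)))"
  unfolding power_mean_le_def
proof (intro allI impI)
  fix \<alpha> \<beta> :: real
  assume pos: "0 < \<alpha>" "0 < \<beta>" and le: "ennreal (1 / \<alpha> ^ k) \<le> ennreal (exp (- a))"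
    "ennreal (1 / \<beta> ^ k) \<le> ennreal (exp (- b))"
  have pow: "exp (u / real k) ^ k = exp u" for u :: real
    using \<open>0 < k\<close> by (simp add: exp_of_nat_mult[symmetric])
  have root: "exp (u / real k) \<le> \<gamma>" if "0 < \<gamma>" "ennreal (1 / \<gamma> ^ k) \<le> ennreal (exp (- u))" for \<gamma> u :: real
  proof (rule power_le_imp_le_base)
    have "1 / \<gamma> ^ k \<le> exp (- u)" using that(2) by simp
    hence "exp u \<le> \<gamma> ^ k" using that(1) by (simp add: exp_minus field_simps)
    thus "exp (u / real k) ^ Suc (k - 1) \<le> \<gamma> ^ Suc (k - 1)" using \<open>0 < k\<close> by (simp add: pow del: power_Suc)
  qed (use that in simp)
  have "exp (c / real k) \<le> (\<alpha> + \<beta>) / 2"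
  proof -
    have "(exp (a / real k) + exp (b / real k)) / 2 \<le> (\<alpha> + \<beta>) / 2"
      by (intro divide_right_mono add_mono root pos le) simp
    with assms(2) show ?thesis by (rule order_trans)
  qed
  hence "exp c \<le> ((\<alpha> + \<beta>) / 2) ^ k"
    unfolding pow[of c, symmetric] by (rule power_mono) simp
  hence "1 / ((\<alpha> + \<beta>) / 2) ^ k \<le> exp (- c)"
    using pos by (simp add: exp_minus field_simps)
  thus "ennreal (1 / ((\<alpha> + \<beta>) / 2) ^ k) \<le> ennreal (exp (- c))" by (rule ennreal_leI)
qed

lemma grad_eq_0_outside:
  fixes f :: "real^'n \<Rightarrow> real"
  assumes "\<And>x. R < norm x \<Longrightarrow> f x = 0" "R < norm x"
  shows "grad f x = 0"
proof -
  have "open {x :: real^'n. R < norm x}" by (intro open_Collect_less continuous_intros)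
  hence "(f has_derivative (\<lambda>_. 0)) (at x)"
    using assms by (intro has_derivative_transform_within_open[OF has_derivative_const[of 0]]) auto
  from frechet_derivative_at[OF this] show ?thesis
    unfolding grad_def by (metis (mono_tags, lifting) vec_eq_iff vec_lambda_beta zero_index)
qed

lemma bounded_if_continuous_zero_outside:
  fixes g :: "'a::euclidean_space \<Rightarrow> real"
  assumes "continuous_on UNIV g" "\<And>x. R < norm x \<Longrightarrow> g x = 0"
  obtains M where "0 \<le> M" "\<And>x. \<bar>g x\<bar> \<le> M"
proof -
  have "bounded (g ` cball 0 R)"
    using assms(1) by (intro compact_imp_bounded compact_continuous_image) (auto intro: continuous_on_subset)
  then obtain M where "\<And>x. norm x \<le> R \<Longrightarrow> \<bar>g x\<bar> \<le> M"
    unfolding bounded_iff by (metis image_eqI mem_cball_0 real_norm_def)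
  hence "\<bar>g x\<bar> \<le> max M 0" for x
    using assms(2)[of x] by (cases "norm x \<le> R") (auto intro: max.cobounded1 order_trans)
  thus thesis by (intro that[of "max M 0"]) auto
qed

text \<open>Since \<open>f\<close> has mean zero, the terms of order \<open>s\<close> vanish and \<open>s\<close> and \<open>- s\<close> give the same lower bound;
division by \<open>s\<^sup>2 / 2\<close> and \<open>s \<rightarrow> 0\<close> leave the comparison of the second-order coefficients.\<close>

lemma (in prob_space) expectation_second_order_bound:
  fixes f \<kappa> :: "'a \<Rightarrow> real"
  assumes [measurable]: "f \<in> borel_measurable M" "\<kappa> \<in> borel_measurable M"
    and bf: "\<And>x. \<bar>f x\<bar> \<le> B" and b\<kappa>: "\<And>x. \<bar>\<kappa> x\<bar> \<le> C" and mean: "expectation f = 0"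
    and "0 < s0"
    and min_le: "\<And>s. 0 < s \<Longrightarrow> s < s0 \<Longrightarrow>
       min (\<integral>\<^sup>+x. ennreal (exp (s * f x)) \<partial>M) (\<integral>\<^sup>+x. ennreal (exp (- s * f x)) \<partial>M)
         \<le> (\<integral>\<^sup>+x. ennreal (exp (s\<^sup>2 / 2 * \<kappa> x)) \<partial>M)"
  shows "expectation (\<lambda>x. (f x)\<^sup>2) \<le> expectation \<kappa>"
proof -
  have bdd: "integrable M u" if "\<And>x. \<bar>u x\<bar> \<le> K" "u \<in> borel_measurable M" for u :: "'a \<Rightarrow> real" and K
    using that by (intro integrable_const_bound[where B=K]) auto
  have B: "0 \<le> B" and C: "0 \<le> C" using bf b\<kappa> by (meson abs_ge_zero order_trans)+
  have int_f: "integrable M f" by (rule bdd[OF bf]) simp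
  have int_f2: "integrable M (\<lambda>x. (f x)\<^sup>2)"
    by (rule bdd[of _ "B\<^sup>2"]) (use bf abs_le_square_iff[of "f _" B] B in auto)
  have int_\<kappa>: "integrable M \<kappa>" by (rule bdd[OF b\<kappa>]) simp
  have exp_eq: "(\<integral>\<^sup>+x. ennreal (exp (u x)) \<partial>M) = ennreal (expectation (\<lambda>x. exp (u x)))"
    and exp_int: "integrable M (\<lambda>x. exp (u x))"
    if "\<And>x. \<bar>u x\<bar> \<le> 1" and [measurable]: "u \<in> borel_measurable M" for u :: "'a \<Rightarrow> real"
  proof -
    show *: "integrable M (\<lambda>x. exp (u x))"
      by (rule bdd[of _ "exp 1"]) (use that(1) in \<open>auto simp: abs_le_iff\<close>)
    show "(\<integral>\<^sup>+x. ennreal (exp (u x)) \<partial>M) = ennreal (expectation (\<lambda>x. exp (u x)))"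
      by (rule nn_integral_eq_integral[OF *]) simp
  qed
  have key: "expectation (\<lambda>x. (f x)\<^sup>2) \<le> expectation \<kappa> + (2 * B ^ 3 * s + C\<^sup>2 * s\<^sup>2)"
    if s: "0 < s" "s < s0" "s < 1" "s * B < 1" "s * C < 1" for s
  proof -
    have lower: "1 + \<sigma> * s * expectation f + s\<^sup>2 / 2 * expectation (\<lambda>x. (f x)\<^sup>2) - s ^ 3 * B ^ 3
        \<le> expectation (\<lambda>x. exp (\<sigma> * s * f x))" if \<sigma>: "\<bar>\<sigma>\<bar> = 1" for \<sigma>
    proof -
      have ab: "\<bar>\<sigma> * s * f x\<bar> \<le> s * B" for x
        using bf[of x] s \<sigma> by (simp add: abs_mult mult_left_mono)
      have "1 + \<sigma> * s * f x + s\<^sup>2 / 2 * (f x)\<^sup>2 - s ^ 3 * B ^ 3 \<le> exp (\<sigma> * s * f x)" for x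
      proof -
        let ?u = "\<sigma> * s * f x"
        have "\<bar>?u\<bar> ^ 3 \<le> (s * B) ^ 3" using ab by (intro power_mono) auto
        moreover have "\<bar>exp ?u - (1 + ?u + ?u\<^sup>2 / 2)\<bar> \<le> \<bar>?u\<bar> ^ 3"
          using ab[of x] s by (intro exp_third_order) linarith
        moreover have "?u\<^sup>2 / 2 = s\<^sup>2 / 2 * (f x)\<^sup>2"
        proof -
          have "\<sigma>\<^sup>2 = 1" using \<sigma> by (metis power2_abs one_power2)
          thus ?thesis by (simp add: power_mult_distrib)
        qed
        ultimately show ?thesis unfolding power_mult_distrib[of s B] by linarith
      qed
      hence "expectation (\<lambda>x. 1 + \<sigma> * s * f x + s\<^sup>2 / 2 * (f x)\<^sup>2 - s ^ 3 * B ^ 3) \<le> expectation (\<lambda>x. exp (\<sigma> * s * f x))"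
      proof (intro integral_mono exp_int)
        show "integrable M (\<lambda>x. 1 + \<sigma> * s * f x + s\<^sup>2 / 2 * (f x)\<^sup>2 - s ^ 3 * B ^ 3)"
          by (intro Bochner_Integration.integrable_add Bochner_Integration.integrable_diff
              integrable_mult_right int_f int_f2 integrable_const)
        show "\<bar>\<sigma> * s * f x\<bar> \<le> 1" for x using ab[of x] s by linarith
      qed auto
      thus ?thesis using int_f int_f2 by (simp add: prob_space)
    qed
    have abk: "\<bar>s\<^sup>2 / 2 * \<kappa> x\<bar> \<le> s\<^sup>2 / 2 * C" for x
      using b\<kappa>[of x] by (simp add: abs_mult mult_left_mono)
    have sC: "s\<^sup>2 / 2 * C \<le> 1"
    proof -
      have "s * (s * C) \<le> 1 * 1" using s C by (intro mult_mono) auto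
      thus ?thesis by (simp add: power2_eq_square mult.assoc)
    qed
    have upper: "expectation (\<lambda>x. exp (s\<^sup>2 / 2 * \<kappa> x)) \<le> 1 + s\<^sup>2 / 2 * expectation \<kappa> + 2 * (s\<^sup>2 / 2 * C)\<^sup>2"
    proof -
      have "exp (s\<^sup>2 / 2 * \<kappa> x) \<le> 1 + s\<^sup>2 / 2 * \<kappa> x + 2 * (s\<^sup>2 / 2 * C)\<^sup>2" for x
      proof -
        have "(s\<^sup>2 / 2 * \<kappa> x)\<^sup>2 \<le> (s\<^sup>2 / 2 * C)\<^sup>2"
          using abk[of x] C by (subst abs_le_square_iff[symmetric]) (simp add: abs_mult)
        thus ?thesis using exp_second_order[of "s\<^sup>2 / 2 * \<kappa> x"] abk[of x] sC unfolding abs_le_iff by linarith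
      qed
      hence "expectation (\<lambda>x. exp (s\<^sup>2 / 2 * \<kappa> x)) \<le> expectation (\<lambda>x. 1 + s\<^sup>2 / 2 * \<kappa> x + 2 * (s\<^sup>2 / 2 * C)\<^sup>2)"
      proof (intro integral_mono exp_int)
        show "integrable M (\<lambda>x. 1 + s\<^sup>2 / 2 * \<kappa> x + 2 * (s\<^sup>2 / 2 * C)\<^sup>2)"
          by (intro Bochner_Integration.integrable_add integrable_mult_right int_\<kappa> integrable_const)
      qed (use order_trans[OF abk sC] in auto)
      thus ?thesis using int_\<kappa> by (simp add: prob_space)
    qed
    have ab: "\<bar>s * f x\<bar> \<le> 1" "\<bar>- s * f x\<bar> \<le> 1" for x
    proof -
      have "\<bar>s * f x\<bar> \<le> s * B" using bf[of x] s by (simp add: abs_mult mult_left_mono)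
      with s show le: "\<bar>s * f x\<bar> \<le> 1" by linarith
      have "- s * f x = - (s * f x)" by simp
      with le show "\<bar>- s * f x\<bar> \<le> 1" by (simp only: abs_minus_cancel)
    qed
    have "min (ennreal (expectation (\<lambda>x. exp (s * f x)))) (ennreal (expectation (\<lambda>x. exp (- s * f x))))
        \<le> ennreal (expectation (\<lambda>x. exp (s\<^sup>2 / 2 * \<kappa> x)))"
      using min_le[OF s(1,2)] exp_eq[OF ab(1)] exp_eq[OF ab(2)] exp_eq[OF order_trans[OF abk sC]] by simp
    hence "min (expectation (\<lambda>x. exp (s * f x))) (expectation (\<lambda>x. exp (- s * f x)))
        \<le> expectation (\<lambda>x. exp (s\<^sup>2 / 2 * \<kappa> x))"
      unfolding min_le_iff_disj by (subst (asm) (1 2) ennreal_le_iff) (auto intro: integral_nonneg_AE)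
    hence "s\<^sup>2 / 2 * expectation (\<lambda>x. (f x)\<^sup>2) - s ^ 3 * B ^ 3 \<le> s\<^sup>2 / 2 * expectation \<kappa> + 2 * (s\<^sup>2 / 2 * C)\<^sup>2"
      using lower[of 1] lower[of "-1"] upper mean by (simp add: min_def split: if_splits)
    hence "s\<^sup>2 / 2 * expectation (\<lambda>x. (f x)\<^sup>2) \<le> s\<^sup>2 / 2 * (expectation \<kappa> + (2 * B ^ 3 * s + C\<^sup>2 * s\<^sup>2))"
      by (simp add: algebra_simps power2_eq_square power3_eq_cube)
    thus ?thesis using s(1) by (simp add: mult_le_cancel_left_pos)
  qed
  have "((\<lambda>s. expectation \<kappa> + (2 * B ^ 3 * s + C\<^sup>2 * s\<^sup>2)) \<longlongrightarrow> expectation \<kappa> + (2 * B ^ 3 * 0 + C\<^sup>2 * 0\<^sup>2)) (at_right 0)"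
    by (intro tendsto_intros)
  hence lim: "((\<lambda>s. expectation \<kappa> + (2 * B ^ 3 * s + C\<^sup>2 * s\<^sup>2)) \<longlongrightarrow> expectation \<kappa>) (at_right 0)" by simp
  have "\<forall>\<^sub>F s in at_right 0. expectation (\<lambda>x. (f x)\<^sup>2) \<le> expectation \<kappa> + (2 * B ^ 3 * s + C\<^sup>2 * s\<^sup>2)"
  proof -
    define e where "e = min (min s0 1) (min (1 / (B + 1)) (1 / (C + 1)))"
    have "0 < e" using \<open>0 < s0\<close> B C by (simp add: e_def)
    have small: "s * K < 1" if "0 < s" "s < 1 / (K + 1)" "0 \<le> K" for s K :: real
      using that by (simp add: pos_less_divide_eq distrib_left)
    have "expectation (\<lambda>x. (f x)\<^sup>2) \<le> expectation \<kappa> + (2 * B ^ 3 * s + C\<^sup>2 * s\<^sup>2)" if "0 < s" "s < e" for s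
      using that B C small[of s B] small[of s C] by (intro key) (auto simp: e_def)
    thus ?thesis using \<open>0 < e\<close> by (auto simp: eventually_at_right_field)
  qed
  from tendsto_lowerbound[OF lim this] show ?thesis by simp
qed

theorem theorem4p3:
  fixes V f :: "real^'n \<Rightarrow> real" and \<mu> :: "(real^'n) measure"
  assumes "prob_space \<mu>"
    and "\<mu> = density lborel (\<lambda>x. ennreal (exp (- V x)))"
    and "C2 V"
    and "\<forall>x. pos_def (hess V x)"
    and "C1 f"
    and "compactly_supported f"
    and "(\<integral>x. f x \<partial>\<mu>) = 0"
  shows "Var \<mu> f \<le>
      (\<integral>x. grad f x \<bullet> (matrix_inv (hess V x) *v grad f x) \<partial>\<mu>)
    - (\<integral>x. (f x - grad f x \<bullet> (matrix_inv (hess V x) *v grad V x))\<^sup>2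
           / (real CARD('n) + grad V x \<bullet> (matrix_inv (hess V x) *v grad V x)) \<partial>\<mu>)"
proof -
  interpret prob_space \<mu> by (rule assms(1))
  have pd: "pos_def (hess V x)" for x using assms(4) by simp
  note V = \<open>C2 V\<close> pd
  let ?N = "real CARD('n)"
  have N: "0 < ?N" by simp
  have contV: "continuous_on UNIV (hess V)" "continuous_on UNIV (grad V)" "continuous_on UNIV V"
    using C1_continuous[OF C2_imp_C1[OF \<open>C2 V\<close>]] \<open>C2 V\<close> by (auto simp: C2_def C1_def)
  have contf: "continuous_on UNIV (grad f)" "continuous_on UNIV f"
    using \<open>C1 f\<close> C1_continuous by (auto simp: C1_def)
  have sets: "sets \<mu> = sets borel" by (simp add: assms(2))
  have meas: "g \<in> borel_measurable \<mu>" if "continuous_on UNIV g" for g :: "real^'n \<Rightarrow> real"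
    using borel_measurable_continuous_onI[OF that] by (simp add: measurable_cong_sets[OF sets refl])
  have "bounded (closure {x. f x \<noteq> 0})"
    using assms(6) by (simp add: compactly_supported_def compact_imp_bounded)
  then obtain R where "\<And>x. x \<in> closure {x. f x \<noteq> 0} \<Longrightarrow> norm x \<le> R" by (auto simp: bounded_iff)
  hence f0: "f x = 0" if "R < norm x" for x using that closure_subset[of "{x. f x \<noteq> 0}"] by force
  hence g0: "grad f x = 0" if "R < norm x" for x using that by (rule grad_eq_0_outside)
  let ?inv = "\<lambda>b x. matrix_inv (hess V x) *v b x"
  have cont_inv: "continuous_on UNIV (?inv b)" if "continuous_on UNIV b" for b
    using contV(1) that pos_def_invertible[OF pd] by (rule continuous_on_matrix_inv_vector)
  define K1 where "K1 x = grad f x \<bullet> ?inv (grad f) x" for x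
  define K2 where "K2 x = (f x - grad f x \<bullet> ?inv (grad V) x)\<^sup>2 / (?N + grad V x \<bullet> ?inv (grad V) x)" for x
  have den: "?N + grad V x \<bullet> ?inv (grad V) x \<noteq> 0" for x
    using pos_def_inv_nonneg[OF pd, of "grad V x" x] N by linarith
  have contK: "continuous_on UNIV K1" "continuous_on UNIV K2"
    unfolding K1_def K2_def using den by (intro continuous_intros cont_inv contV contf; simp)+
  have K0: "K1 x = 0" "K2 x = 0" if "R < norm x" for x
    using f0[OF that] g0[OF that] by (auto simp: K1_def K2_def)
  have integrable_cont: "integrable \<mu> g" if g: "continuous_on UNIV g" "\<And>x. R < norm x \<Longrightarrow> g x = 0" for g :: "real^'n \<Rightarrow> real"
  proof -
    obtain M where "\<And>x. \<bar>g x\<bar> \<le> M" using bounded_if_continuous_zero_outside[OF g] by metis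
    thus ?thesis by (intro integrable_const_bound[where B=M] meas g(1)) auto
  qed
  define K where "K x = bl_density ?N (hess V x) (grad V x) (grad f x) (f x)" for x
  have K_eq: "K x = K1 x - K2 x" for x by (simp add: K_def bl_density_def K1_def K2_def)
  have contK': "continuous_on UNIV K" unfolding K_eq by (intro continuous_intros contK)
  have intK: "integrable \<mu> K" unfolding K_eq using integrable_cont contK K0 by auto
  obtain Bf where Bf: "\<And>x. \<bar>f x\<bar> \<le> Bf" using bounded_if_continuous_zero_outside[OF contf(2) f0] by metis
  obtain BK where BK: "\<And>x. \<bar>K x\<bar> \<le> BK"
  proof -
    have "K x = 0" if "R < norm x" for x using K0[OF that] by (simp add: K_eq)
    from bounded_if_continuous_zero_outside[OF contK' this] show thesis using that by metis
  qed
  have "expectation (\<lambda>x. (f x)\<^sup>2) \<le> expectation K + \<epsilon>" if "0 < \<epsilon>" for \<epsilon>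
  proof -
    let ?S = "cball (0 :: real^'n) (R + 1)"
    \<comment> \<open>The summand \<open>\<epsilon>\<close> makes the quadratic form strictly positive; cutting off at radius \<open>R + 1\<close> leaves a
      margin of width one around the support of \<open>f\<close>, where \<open>K\<close> vanishes but \<open>k = \<epsilon>\<close>.\<close>
    define \<kappa> where "\<kappa> x = K x + \<epsilon>" for x
    define k where "k x = indicator ?S x * \<kappa> x" for x
    have cont\<kappa>: "continuous_on UNIV \<kappa>" unfolding \<kappa>_def by (intro continuous_intros contK')
    have pos: "0 < h \<bullet> (hess V z *v h) + 2 * s * (grad f z \<bullet> h) + (grad V z \<bullet> h + s * f z)\<^sup>2 / ?N + s\<^sup>2 * \<kappa> z"
      if "(h, s) \<noteq> 0" for z h s
    proof (cases "s = 0")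
      case True
      hence "0 < h \<bullet> (hess V z *v h)" using that pd by (auto simp: pos_def_def zero_prod_def)
      thus ?thesis using True by (simp add: add_pos_nonneg)
    next
      case False
      have "0 \<le> h \<bullet> (hess V z *v h) + 2 * s * (grad f z \<bullet> h) + (grad V z \<bullet> h + s * f z)\<^sup>2 / ?N + s\<^sup>2 * K z"
        unfolding K_def by (rule bl_density_quadratic_nonneg[OF pd hess_symmetric[OF \<open>C2 V\<close>] N])
      moreover have "0 < s\<^sup>2 * \<epsilon>" using False \<open>0 < \<epsilon>\<close> by simp
      ultimately show ?thesis by (simp add: \<kappa>_def distrib_left)
    qed
    have b\<kappa>: "\<bar>\<kappa> x\<bar> \<le> BK + \<epsilon>" for x using BK[of x] \<open>0 < \<epsilon>\<close> unfolding \<kappa>_def by linarith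
    obtain s0 where s0: "0 < s0"
      "\<And>s x y. \<bar>s\<bar> < s0 \<Longrightarrow> exp ((V ((1/2) *\<^sub>R (x + y)) - s\<^sup>2 / 2 * k ((1/2) *\<^sub>R (x + y))) / ?N)
       \<le> (exp ((V x - s * f x) / ?N) + exp ((V y + s * f y) / ?N)) / 2"
      unfolding k_def
      using global_comparison[OF V \<open>C1 f\<close> cont\<kappa> f0 N pos Bf b\<kappa>, of R] by blast
    have [measurable]: "V \<in> borel_measurable borel" "f \<in> borel_measurable borel" "\<kappa> \<in> borel_measurable borel"
      using contV contf cont\<kappa> by (auto intro: borel_measurable_continuous_onI)
    have [measurable]: "?S \<in> sets borel" by simp
    have [measurable]: "k \<in> borel_measurable borel" unfolding k_def by measurable
    have dens: "(\<integral>\<^sup>+x. ennreal (exp (u x)) \<partial>\<mu>) = (\<integral>\<^sup>+x. ennreal (exp (- (V x - u x))) \<partial>lborel)"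
      if [measurable]: "u \<in> borel_measurable borel" for u
      unfolding assms(2) by (subst nn_integral_density) (auto simp: ennreal_mult[symmetric] exp_add[symmetric])
    have bk: "\<bar>k x\<bar> \<le> BK + \<epsilon>" for x
      using b\<kappa>[of x] abs_ge_zero[of "\<kappa> x"] by (auto simp: k_def split: split_indicator simp del: abs_ge_zero)
    have "expectation (\<lambda>x. (f x)\<^sup>2) \<le> expectation k"
    proof (rule expectation_second_order_bound[OF _ _ Bf bk _ s0(1)])
      fix s assume s: "0 < s" "s < s0"
      have "min (\<integral>\<^sup>+x. ennreal (exp (- (V x - s * f x))) \<partial>lborel) (\<integral>\<^sup>+x. ennreal (exp (- (V x + s * f x))) \<partial>lborel)
         \<le> (\<integral>\<^sup>+x. ennreal (exp (- (V x - s\<^sup>2 / 2 * k x))) \<partial>lborel)"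
      proof (rule borell_brascamp_lieb)
        fix x y :: "real^'n"
        show "power_mean_le DIM(real^'n) (ennreal (exp (- (V x - s * f x)))) (ennreal (exp (- (V y + s * f y))))
          (ennreal (exp (- (V ((1/2) *\<^sub>R (x + y)) - s\<^sup>2 / 2 * k ((1/2) *\<^sub>R (x + y))))))"
          using s0(2)[of s x y] s by (intro power_mean_le_exp) auto
      qed measurable
      thus "min (\<integral>\<^sup>+x. ennreal (exp (s * f x)) \<partial>\<mu>) (\<integral>\<^sup>+x. ennreal (exp (- s * f x)) \<partial>\<mu>)
         \<le> (\<integral>\<^sup>+x. ennreal (exp (s\<^sup>2 / 2 * k x)) \<partial>\<mu>)"
        by (simp add: dens)
    qed (use assms(7) in \<open>simp_all add: measurable_cong_sets[OF sets refl]\<close>)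
    also have "expectation k = expectation (\<lambda>x. K x + \<epsilon> * indicator ?S x)"
    proof (rule arg_cong[where f = expectation], rule ext)
      fix x show "k x = K x + \<epsilon> * indicator ?S x"
        using K0[of x] by (auto simp: k_def \<kappa>_def K_eq split: split_indicator)
    qed
    also have "\<dots> = expectation K + \<epsilon> * prob ?S"
    proof -
      have "integrable \<mu> (indicator ?S :: real^'n \<Rightarrow> real)"
        by (intro integrable_real_indicator) (auto simp: sets less_top[symmetric])
      thus ?thesis using intK by (subst Bochner_Integration.integral_add) (auto simp: assms(2))
    qed
    also have "\<dots> \<le> expectation K + \<epsilon>" using \<open>0 < \<epsilon>\<close> by (simp add: mult_left_le)
    finally show ?thesis .
  qed
  hence "expectation (\<lambda>x. (f x)\<^sup>2) \<le> expectation K" by (rule field_le_epsilon)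
  also have "\<dots> = expectation K1 - expectation K2"
    unfolding K_eq by (intro Bochner_Integration.integral_diff integrable_cont contK K0)
  finally show ?thesis
    using assms(7) by (simp add: Var_def K1_def[abs_def] K2_def[abs_def])
qed

end
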